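(* Let $F$ be a finite extension of $\mathbb{Q}_p$ with ring of integers $\mathcal{O}_F$ and uniformizer $\pi_F$, let $G=\mathrm{GL}_2(F)$, $K=\mathrm{GL}_2(\mathcal{O}_F)$, and $\Gamma_0(\pi_F)=\left\{\begin{pmatrix} a&b\\ c&d\end{pmatrix}\in K : c\equiv 0 \bmod \pi_F\right\}$. Let $(\pi_1,V_1)$, $(\pi_2,V_2)$, $(\pi_3,V_3)$ be irreducible, admissible, infinite-dimensional representations of $G$ such that the product of their central characters is trivial, where $\pi_1$ and $\pi_2$ are unramified principal series representations and $\pi_3$ has conductor $n=1$. Write $\pi_i=\mathrm{Ind}_B^G\chi_i$ ($i=1,2$), where $B$ is the Borel subgroup of upper triangular matrices and $\chi_1,\chi_2$ are unramified characters of $B$ (trivial on the unipotent radical), and assume $$\chi_1\begin{pmatrix}\pi_F&0\\0&\pi_F^{-1}\end{pmatrix}\neq -1\quad\text{or}\quad \chi_2\begin{pmatrix}\pi_F&0\\0&\pi_F^{-1}\end{pmatrix}\neq -1.$$ Let $\ell$ be a nonzero $G$-invariant linear form on $V_1\otimes V_2\otimes V_3$ (such a form exists and is unique up to scalar). Let $v_1\in V_1$, $v_2\in V_2$ be nonzero $K$-fixed vectors, let $v_3\in V_3$ be a nonzero $\Gamma_0(\pi_F)$-fixed vector (new vector), let $\gamma=\begin{pmatrix}\pi_F&0\\0&1\end{pmatrix}$ and $v_2^*=\pi_2(\gamma^{-1})v_2$. Then $\ell(v_1\otimes v_2^*\otimes v_3)\neq 0$, i.e. $v_1\otimes v_2^*\otimes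 v_3$ is a test vector for $\ell$.
   Context: Induction is normalized: $\mathrm{Ind}_B^G\chi$ consists of smooth functions $f:G\to\mathbb{C}$ with $f(bg)=\chi(b)\delta(b)^{1/2}f(g)$ for $b\in B$, where $\delta\begin{pmatrix}a&b\\0&d\end{pmatrix}=|a/d|$, and $G$ acts by right translation. The vector $v_2^*$ is fixed by $R^*=\gamma^{-1}K\gamma$, and $R^*\cap K=\Gamma_0(\pi_F)$. *)

theory Defs
  imports
    "HOL-Analysis.Analysis"
    "HOL-Computational_Algebra.Primes"
    "HOL-Library.Function_Algebras"
    "HOL-Algebra.Group"
begin

section \<open>Finite extensions of the p-adic numbers\<close>

definition padic_abs :: "nat \<Rightarrow> rat \<Rightarrow> real" where
  "padic_abs p r =
    (if r = 0 then 0
     else real p powi (int (multiplicity (int p) (snd (quotient_of r)))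
                     - int (multiplicity (int p) (fst (quotient_of r)))))"

definition av_dist :: "('f::ab_group_add \<Rightarrow> real) \<Rightarrow> 'f \<Rightarrow> 'f \<Rightarrow> real" where
  "av_dist av x y = av (x - y)"

text \<open>
  The type \<open>'f\<close> is a finite extension of its subfield \<open>Qp\<close>, and \<open>Qp\<close> is the completion of the
  rationals for the p-adic absolute value. The unique extension of that absolute value to \<open>'f\<close>
  is carried along as \<open>av\<close>. It extends the p-adic absolute value without rescaling, so it is in
  general not the normalized absolute value of \<open>'f\<close>; see \<open>normalized_abs\<close> below.
\<close>

locale padic_field =
  fixes p :: nat and Qp :: "'f::field_char_0 set" and av :: "'f \<Rightarrow> real"
  assumes prime_p: "prime p"
    and av_nonneg: "0 \<le> av x"
    and av_eq_0_iff: "av x = 0 \<longleftrightarrow> x = 0"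
    and av_mult: "av (x * y) = av x * av y"
    and av_ultrametric: "av (x + y) \<le> max (av x) (av y)"
    and av_of_rat: "av (of_rat r) = padic_abs p r"
    and Qp_1: "1 \<in> Qp"
    and Qp_diff: "x \<in> Qp \<Longrightarrow> y \<in> Qp \<Longrightarrow> x - y \<in> Qp"
    and Qp_mult: "x \<in> Qp \<Longrightarrow> y \<in> Qp \<Longrightarrow> x * y \<in> Qp"
    and Qp_inverse: "x \<in> Qp \<Longrightarrow> inverse x \<in> Qp"
    and Qp_complete: "Metric_space.mcomplete Qp (av_dist av)"
    and Rats_dense: "Metric_space.mtopology Qp (av_dist av) closure_of \<rat> = Qp"
    and finite_extension: "\<exists>B. finite B \<and> (\<forall>x. \<exists>c. (\<forall>b\<in>B. c b \<in> Qp) \<and> x = (\<Sum>b\<in>B. c b * b))"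

definition integers :: "('f::field \<Rightarrow> real) \<Rightarrow> 'f set" where
  "integers av = {x. av x \<le> 1}"

definition uniformizer :: "('f::field \<Rightarrow> real) \<Rightarrow> 'f \<Rightarrow> bool" where
  "uniformizer av \<pi> \<longleftrightarrow> {x. av x < 1} = (\<lambda>y. \<pi> * y) ` integers av"

definition residue_card :: "('f::field \<Rightarrow> real) \<Rightarrow> nat" where
  "residue_card av =
    card (integers av // {(x, y). x \<in> integers av \<and> y \<in> integers av \<and> av (x - y) < 1})"

definition valuation :: "('f::field \<Rightarrow> real) \<Rightarrow> 'f \<Rightarrow> 'f \<Rightarrow> int" where
  "valuation av \<pi> x = (THE k. \<exists>u. av u = 1 \<and> x = \<pi> powi k * u)"

definition normalized_abs :: "('f::field \<Rightarrow> real) \<Rightarrow> 'f \<Rightarrow> 'f \<Rightarrow> real" where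
  "normalized_abs av \<pi> x =
    (if x = 0 then 0 else real (residue_card av) powi (- valuation av \<pi> x))"

section \<open>The group and its subgroups\<close>

type_synonym 'f mat2 = "'f ^ 2 ^ 2"

definition mat2 :: "'f \<Rightarrow> 'f \<Rightarrow> 'f \<Rightarrow> 'f \<Rightarrow> 'f::zero mat2" where
  "mat2 a b c d = vector [vector [a, b], vector [c, d]]"

definition GL2 :: "'f::field mat2 monoid" where
  "GL2 = \<lparr>carrier = {g. invertible g}, mult = (**), one = mat 1\<rparr>"

definition mat2_dist :: "('f::field \<Rightarrow> real) \<Rightarrow> 'f mat2 \<Rightarrow> 'f mat2 \<Rightarrow> real" where
  "mat2_dist av A B = Max (range (\<lambda>(i, j). av_dist av (A $ i $ j) (B $ i $ j)))"

definition GL2_topology :: "('f::field \<Rightarrow> real) \<Rightarrow> 'f mat2 topology" where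
  "GL2_topology av =
    subtopology (Metric_space.mtopology UNIV (mat2_dist av)) (carrier GL2)"

definition open_subgroup :: "('f::field \<Rightarrow> real) \<Rightarrow> 'f mat2 set \<Rightarrow> bool" where
  "open_subgroup av H \<longleftrightarrow> subgroup H GL2 \<and> openin (GL2_topology av) H"

definition GL2_integers :: "('f::field \<Rightarrow> real) \<Rightarrow> 'f mat2 set" where
  "GL2_integers av = {g. (\<forall>i j. g $ i $ j \<in> integers av) \<and> av (det g) = 1}"

definition cong_zero :: "('f::field \<Rightarrow> real) \<Rightarrow> 'f \<Rightarrow> nat \<Rightarrow> 'f \<Rightarrow> bool" where
  "cong_zero av \<pi> n x \<longleftrightarrow> x \<in> (\<lambda>y. \<pi> ^ n * y) ` integers av"

definition Gamma0 :: "('f::field \<Rightarrow> real) \<Rightarrow> 'f \<Rightarrow> 'f mat2 set" where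
  "Gamma0 av \<pi> = {g \<in> GL2_integers av. cong_zero av \<pi> 1 (g $ 2 $ 1)}"

definition Gamma1 :: "('f::field \<Rightarrow> real) \<Rightarrow> 'f \<Rightarrow> nat \<Rightarrow> 'f mat2 set" where
  "Gamma1 av \<pi> n =
    {g \<in> GL2_integers av. cong_zero av \<pi> n (g $ 2 $ 1) \<and> cong_zero av \<pi> n (g $ 2 $ 2 - 1)}"

definition borel_subgroup :: "'f::field mat2 set" where
  "borel_subgroup = {b \<in> carrier GL2. b $ 2 $ 1 = 0}"

section \<open>Representations\<close>

locale GL2_rep = vector_space sc
  for sc :: "complex \<Rightarrow> 'v::ab_group_add \<Rightarrow> 'v" +
  fixes \<rho> :: "'f::field mat2 \<Rightarrow> 'v \<Rightarrow> 'v"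
  assumes rep_linear: "g \<in> carrier GL2 \<Longrightarrow> Vector_Spaces.linear sc sc (\<rho> g)"
    and rep_one: "\<rho> (mat 1) v = v"
    and rep_mult: "g \<in> carrier GL2 \<Longrightarrow> h \<in> carrier GL2 \<Longrightarrow> \<rho> (g ** h) v = \<rho> g (\<rho> h v)"

definition fixed_vectors :: "('f mat2 \<Rightarrow> 'v \<Rightarrow> 'v) \<Rightarrow> 'f mat2 set \<Rightarrow> 'v set" where
  "fixed_vectors \<rho> H = {v. \<forall>h\<in>H. \<rho> h v = v}"

definition irreducible_rep ::
    "(complex \<Rightarrow> 'v::ab_group_add \<Rightarrow> 'v) \<Rightarrow> ('f::field mat2 \<Rightarrow> 'v \<Rightarrow> 'v) \<Rightarrow> bool" where
  "irreducible_rep sc \<rho> \<longleftrightarrow>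
    (\<exists>v::'v. v \<noteq> 0) \<and>
    (\<forall>W. module.subspace sc W \<and> (\<forall>g\<in>carrier GL2. \<rho> g ` W \<subseteq> W) \<longrightarrow> W = {0} \<or> W = UNIV)"

definition admissible_rep ::
    "('f::field \<Rightarrow> real) \<Rightarrow> (complex \<Rightarrow> 'v::ab_group_add \<Rightarrow> 'v) \<Rightarrow> ('f mat2 \<Rightarrow> 'v \<Rightarrow> 'v) \<Rightarrow> bool" where
  "admissible_rep av sc \<rho> \<longleftrightarrow>
    (\<forall>v. \<exists>H. open_subgroup av H \<and> v \<in> fixed_vectors \<rho> H) \<and>
    (\<forall>H. open_subgroup av H \<longrightarrow> (\<exists>B. finite B \<and> fixed_vectors \<rho> H \<subseteq> module.span sc B))"

definition infinite_dimensional :: "(complex \<Rightarrow> 'v::ab_group_add \<Rightarrow> 'v) \<Rightarrow> bool" where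
  "infinite_dimensional sc \<longleftrightarrow> \<not> (\<exists>B. finite B \<and> module.span sc B = UNIV)"

definition has_central_character ::
    "(complex \<Rightarrow> 'v \<Rightarrow> 'v) \<Rightarrow> ('f::field mat2 \<Rightarrow> 'v \<Rightarrow> 'v) \<Rightarrow> ('f \<Rightarrow> complex) \<Rightarrow> bool" where
  "has_central_character sc \<rho> \<omega> \<longleftrightarrow> (\<forall>z v. z \<noteq> 0 \<longrightarrow> \<rho> (mat z) v = sc (\<omega> z) v)"

definition has_conductor ::
    "('f::field \<Rightarrow> real) \<Rightarrow> 'f \<Rightarrow> ('f mat2 \<Rightarrow> 'v::zero \<Rightarrow> 'v) \<Rightarrow> nat \<Rightarrow> bool" where
  "has_conductor av \<pi> \<rho> n \<longleftrightarrow>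
    (\<exists>v \<in> fixed_vectors \<rho> (Gamma1 av \<pi> n). v \<noteq> 0) \<and>
    (\<forall>m<n. \<forall>v \<in> fixed_vectors \<rho> (Gamma1 av \<pi> m). v = 0)"

section \<open>Normalized induction\<close>

definition unramified_character :: "('f::field \<Rightarrow> real) \<Rightarrow> ('f mat2 \<Rightarrow> complex) \<Rightarrow> bool" where
  "unramified_character av chi \<longleftrightarrow>
    (\<forall>b\<in>borel_subgroup. chi b \<noteq> 0) \<and>
    (\<forall>b\<in>borel_subgroup. \<forall>b'\<in>borel_subgroup. chi (b ** b') = chi b * chi b') \<and>
    (\<forall>x. chi (mat2 1 x 0 1) = 1) \<and>
    (\<forall>a d. av a = 1 \<and> av d = 1 \<longrightarrow> chi (mat2 a 0 0 d) = 1)"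

definition modulus_character :: "('f::field \<Rightarrow> real) \<Rightarrow> 'f \<Rightarrow> 'f mat2 \<Rightarrow> real" where
  "modulus_character av \<pi> b = normalized_abs av \<pi> (b $ 1 $ 1 / b $ 2 $ 2)"

text \<open>
  Functions on the group are total functions on matrices that vanish outside the group.
  Smoothness is invariance under right translation by a single open subgroup.
\<close>

definition induced_space ::
    "('f::field \<Rightarrow> real) \<Rightarrow> 'f \<Rightarrow> ('f mat2 \<Rightarrow> complex) \<Rightarrow> ('f mat2 \<Rightarrow> complex) set" where
  "induced_space av \<pi> chi =
    {f. (\<forall>g. g \<notin> carrier GL2 \<longrightarrow> f g = 0) \<and>
        (\<forall>b\<in>borel_subgroup. \<forall>g\<in>carrier GL2.
           f (b ** g) = chi b * complex_of_real (sqrt (modulus_character av \<pi> b)) * f g) \<and>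
        (\<exists>H. open_subgroup av H \<and> (\<forall>g\<in>carrier GL2. \<forall>h\<in>H. f (g ** h) = f g))}"

definition isomorphic_to_induced ::
    "('f::field \<Rightarrow> real) \<Rightarrow> 'f \<Rightarrow> (complex \<Rightarrow> 'v::ab_group_add \<Rightarrow> 'v) \<Rightarrow>
     ('f mat2 \<Rightarrow> 'v \<Rightarrow> 'v) \<Rightarrow> ('f mat2 \<Rightarrow> complex) \<Rightarrow> bool" where
  "isomorphic_to_induced av \<pi> sc \<rho> chi \<longleftrightarrow>
    (\<exists>\<Phi>. Vector_Spaces.linear sc (\<lambda>c f x. c * f x) \<Phi> \<and>
         bij_betw \<Phi> UNIV (induced_space av \<pi> chi) \<and>
         (\<forall>g\<in>carrier GL2. \<forall>v. \<Phi> (\<rho> g v) = (\<lambda>x. \<Phi> v (x ** g))))"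

section \<open>Invariant trilinear forms\<close>

text \<open>
  A linear form on the threefold tensor product, given by its values on the pure tensors.
\<close>

definition trilinear_form ::
    "(complex \<Rightarrow> 'u::ab_group_add \<Rightarrow> 'u) \<Rightarrow> (complex \<Rightarrow> 'v::ab_group_add \<Rightarrow> 'v) \<Rightarrow>
     (complex \<Rightarrow> 'w::ab_group_add \<Rightarrow> 'w) \<Rightarrow> ('u \<Rightarrow> 'v \<Rightarrow> 'w \<Rightarrow> complex) \<Rightarrow> bool" where
  "trilinear_form sc1 sc2 sc3 \<l> \<longleftrightarrow>
    (\<forall>y z. Vector_Spaces.linear sc1 (*) (\<lambda>x. \<l> x y z)) \<and>
    (\<forall>x z. Vector_Spaces.linear sc2 (*) (\<lambda>y. \<l> x y z)) \<and>
    (\<forall>x y. Vector_Spaces.linear sc3 (*) (\<lambda>z. \<l> x y z))"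

definition GL2_invariant ::
    "('f::field mat2 \<Rightarrow> 'u \<Rightarrow> 'u) \<Rightarrow> ('f mat2 \<Rightarrow> 'v \<Rightarrow> 'v) \<Rightarrow> ('f mat2 \<Rightarrow> 'w \<Rightarrow> 'w) \<Rightarrow>
     ('u \<Rightarrow> 'v \<Rightarrow> 'w \<Rightarrow> complex) \<Rightarrow> bool" where
  "GL2_invariant \<rho>1 \<rho>2 \<rho>3 \<l> \<longleftrightarrow>
    (\<forall>g\<in>carrier GL2. \<forall>x y z. \<l> (\<rho>1 g x) (\<rho>2 g y) (\<rho>3 g z) = \<l> x y z)"

end

theory Submission
  imports Defs "HOL-Number_Theory.Cong"
begin

text \<open>
  Attach the translates of \<open>v3\<close> to the edges, and those of \<open>v1\<close>, \<open>v2\<close> to the vertices, of the Bruhat-Tits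
  tree. As the third representation has no spherical vector, its translates sum to zero over the
  edges at a vertex, so a linear form on it that is invariant under the pointwise stabilizer of a
  path vanishes once it vanishes on the edges of the path; when the path is a single edge,
  irreducibility moreover makes vanishing on it independent of the orientation. If the form
  vanishes on \<open>v1\<close>, \<open>v2\<^sup>*\<close>, \<open>v3\<close>, then it vanishes on the translates of \<open>v1\<close> and \<open>v2\<close> at distance at most
  one. The Hecke eigenvalue equations at the two ends of a path (spherical vectors being unique up
  to scalars, by the Iwasawa decomposition) propagate this to all distances, and by the Cartan
  decomposition the form is zero. The eigenvalues themselves play no role.
\<close>

text \<open>Write \<open>q\<close> for \<open>card R\<close>, the size of the residue field; it is
  finite because \<open>'f\<close> is finite over \<open>Qp\<close>, and \<open>q \<ge> 2\<close>.
  Moving values outward in the tree divides by \<open>q\<close> or \<open>q - 1\<close>, and a path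
  of length zero leads to a division by \<open>q\<^sup>2 - 1\<close>; none of these is zero.

  The Hecke relation at an end only says that the sum over the \<open>q\<close> prolongations of a
  shorter path vanishes. The terms agree when tested on an edge that does not touch that end,
  because a unipotent element carrying one prolongation to another fixes such an edge. In a path
  with two or more edges every edge avoids one of the ends. A single edge touches both, and this is
  why distance one has to be the starting point and is the place where \<open>v3\<close> enters.

  Reversing an edge must cost only a scalar, so the propagation is run with an eigenvector
  \<open>w\<close> of the reversing matrix \<open>mat2 0 1 \<pi> 0\<close>. The vector
  \<open>v3\<close> is not known to be one, and it has to be replaced without losing the
  vanishing.\<close>

section \<open>The residue field\<close>

text \<open>Gaussian elimination over a subfield given as a set: equation \<open>i0\<close> is
  solved for a pivot unknown \<open>j0\<close>, which is then eliminated from the others. Used with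
  \<open>S = Qp\<close> to compare a residually independent set with a spanning set.\<close>

lemma homogeneous_system_solvable:
  fixes S :: "'f::field set" and A :: "'i \<Rightarrow> 'j \<Rightarrow> 'f"
  assumes S: "1 \<in> S" "\<And>x y. x \<in> S \<Longrightarrow> y \<in> S \<Longrightarrow> x - y \<in> S"
      "\<And>x y. x \<in> S \<Longrightarrow> y \<in> S \<Longrightarrow> x * y \<in> S" "\<And>x. x \<in> S \<Longrightarrow> inverse x \<in> S"
    and "finite I" "finite J" "card I < card J"
    and "\<And>i j. i \<in> I \<Longrightarrow> j \<in> J \<Longrightarrow> A i j \<in> S"
  shows "\<exists>c. (\<forall>j\<in>J. c j \<in> S) \<and> (\<exists>j\<in>J. c j \<noteq> 0) \<and> (\<forall>i\<in>I. (\<Sum>j\<in>J. A i j * c j) = 0)"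
  using assms(5-)
proof (induction I arbitrary: J A rule: finite_induct)
  case empty
  then have "J \<noteq> {}" by auto
  then show ?case using S(1) by (intro exI[of _ "\<lambda>_. 1"]) auto
next
  case (insert i0 I)
  have S0: "0 \<in> S" using S(1) S(2)[of 1 1] by simp
  have Sm: "- x \<in> S" if "x \<in> S" for x using S(2)[OF S0 that] by simp
  have Sp: "x + y \<in> S" if "x \<in> S" "y \<in> S" for x y using S(2)[OF that(1) Sm[OF that(2)]] by simp
  have Ssum: "sum f K \<in> S" if "\<And>k. k \<in> K \<Longrightarrow> f k \<in> S" for f and K :: "'j set"
    using that by (induction K rule: infinite_finite_induct) (auto intro: S0 Sp)
  show ?case
  proof (cases "\<forall>j\<in>J. A i0 j = 0")
    case True
    obtain c where "\<forall>j\<in>J. c j \<in> S" "\<exists>j\<in>J. c j \<noteq> 0" "\<forall>i\<in>I. (\<Sum>j\<in>J. A i j * c j) = 0"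
    proof -
      have "\<exists>c. (\<forall>j\<in>J. c j \<in> S) \<and> (\<exists>j\<in>J. c j \<noteq> 0) \<and> (\<forall>i\<in>I. (\<Sum>j\<in>J. A i j * c j) = 0)"
        by (rule insert.IH) (use insert.prems insert.hyps in auto)
      then show ?thesis using that by blast
    qed
    with True show ?thesis by (intro exI[of _ c]) auto
  next
    case False
    then obtain j0 where j0: "j0 \<in> J" "A i0 j0 \<noteq> 0" by blast
    define J' where "J' = J - {j0}"
    have J: "J = insert j0 J'" "finite J'" "j0 \<notin> J'"
      using j0 insert.prems by (auto simp: J'_def)
    have cJ: "card I < card J'"
      using insert.prems insert.hyps j0 by (simp add: J'_def)
    define A' where "A' i j = A i j - A i j0 * A i0 j * inverse (A i0 j0)" for i j
    have A'S: "A' i j \<in> S" if "i \<in> I" "j \<in> J'" for i j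
      unfolding A'_def using that j0 insert.prems(3) by (intro S) (auto simp: J'_def)
    have "\<exists>c. (\<forall>j\<in>J'. c j \<in> S) \<and> (\<exists>j\<in>J'. c j \<noteq> 0) \<and> (\<forall>i\<in>I. (\<Sum>j\<in>J'. A' i j * c j) = 0)"
      by (rule insert.IH[OF J(2) cJ A'S])
    then obtain c where c: "\<forall>j\<in>J'. c j \<in> S" "\<exists>j\<in>J'. c j \<noteq> 0"
        "\<forall>i\<in>I. (\<Sum>j\<in>J'. A' i j * c j) = 0"
      by blast
    define t where "t = - (\<Sum>j\<in>J'. A i0 j * c j) * inverse (A i0 j0)"
    define c' where "c' j = (if j = j0 then t else c j)" for j
    have tS: "t \<in> S" unfolding t_def
      using c(1) insert.prems(3) j0 by (intro S Sm Ssum) (auto simp: J'_def)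
    have sum_c': "(\<Sum>j\<in>J. B j * c' j) = B j0 * t + (\<Sum>j\<in>J'. B j * c j)" for B
    proof -
      have "(\<Sum>j\<in>J'. B j * c' j) = (\<Sum>j\<in>J'. B j * c j)"
        using J(3) by (intro sum.cong) (auto simp: c'_def)
      then show ?thesis using J by (simp add: c'_def)
    qed
    have "(\<Sum>j\<in>J. A i j * c' j) = 0" if "i \<in> insert i0 I" for i
    proof (cases "i = i0")
      case True
      then show ?thesis using j0(2) by (simp add: sum_c' t_def)
    next
      case False
      then have "(\<Sum>j\<in>J'. A' i j * c j) = 0" using that c by auto
      moreover have "(\<Sum>j\<in>J'. A' i j * c j)
          = (\<Sum>j\<in>J'. A i j * c j) - A i j0 * inverse (A i0 j0) * (\<Sum>j\<in>J'. A i0 j * c j)"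
        by (simp add: A'_def algebra_simps sum_subtractf sum_distrib_left)
      ultimately show ?thesis unfolding sum_c' t_def by (simp add: algebra_simps)
    qed
    moreover have "\<forall>j\<in>J. c' j \<in> S" using tS c(1) by (auto simp: c'_def J'_def)
    moreover have "\<exists>j\<in>J. c' j \<noteq> 0" using c(2) by (auto simp: c'_def J'_def)
    ultimately show ?thesis by blast
  qed
qed

section \<open>Ultrametric absolute values\<close>

locale valued_field =
  fixes av :: "'f::field \<Rightarrow> real"
  assumes av_nonneg: "0 \<le> av x"
    and av_eq_0_iff [simp]: "av x = 0 \<longleftrightarrow> x = 0"
    and av_mult [simp]: "av (x * y) = av x * av y"
    and av_ultrametric: "av (x + y) \<le> max (av x) (av y)"
begin

lemma av_zero [simp]: "av 0 = 0"
  by simp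

lemma av_one [simp]: "av 1 = 1"
  using av_mult[of 1 1] av_eq_0_iff[of 1] by simp

lemma av_pos: "x \<noteq> 0 \<Longrightarrow> 0 < av x"
  using av_nonneg[of x] av_eq_0_iff[of x] by linarith

lemma av_uminus [simp]: "av (- x) = av x"
proof -
  have "av (-1) * av (-1) = 1" using av_mult[of "-1" "-1"] by simp
  then have "av (-1) = 1" using av_nonneg[of "-1"] square_eq_1_iff by force
  then show ?thesis using av_mult[of "-1" x] by simp
qed

lemma av_minus_commute: "av (x - y) = av (y - x)"
  using av_uminus[of "x - y"] by simp

lemma av_inverse [simp]: "av (inverse x) = inverse (av x)"
proof (cases "x = 0")
  case False
  then have "av x * av (inverse x) = 1" using av_mult[of x "inverse x"] by simp
  then show ?thesis using inverse_unique by metis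
qed simp

lemma av_divide [simp]: "av (x / y) = av x / av y"
  by (simp add: divide_inverse)

lemma av_power [simp]: "av (x ^ n) = av x ^ n"
  by (induction n) auto

lemma av_powi [simp]: "av (x powi m) = av x powi m"
  by (simp add: power_int_def)

lemma av_add_le: "av x \<le> r \<Longrightarrow> av y \<le> r \<Longrightarrow> av (x + y) \<le> r"
  using av_ultrametric[of x y] by linarith

lemma av_add_less: "av x < r \<Longrightarrow> av y < r \<Longrightarrow> av (x + y) < r"
  using av_ultrametric[of x y] by linarith

lemma av_diff_le: "av x \<le> r \<Longrightarrow> av y \<le> r \<Longrightarrow> av (x - y) \<le> r"
  using av_add_le[of x r "- y"] by simp

lemma av_diff_less: "av x < r \<Longrightarrow> av y < r \<Longrightarrow> av (x - y) < r"
  using av_add_less[of x r "- y"] by simp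

lemma av_mult_le: "av x \<le> r \<Longrightarrow> av y \<le> 1 \<Longrightarrow> av (x * y) \<le> r"
  using mult_mono[of "av x" r "av y" 1] av_nonneg[of x] av_nonneg[of y] by simp

lemma av_mult_less: "av x < 1 \<Longrightarrow> av y \<le> 1 \<Longrightarrow> av (x * y) < 1"
  using mult_left_le[of "av y" "av x"] av_nonneg[of x] by (simp add: order.strict_trans1)

lemma av_add_eq: "av y < av x \<Longrightarrow> av (x + y) = av x"
  using av_ultrametric[of x y] av_ultrametric[of "x + y" "- y"] by auto

lemma av_sum_less: "0 < r \<Longrightarrow> (\<And>i. i \<in> I \<Longrightarrow> av (f i) < r) \<Longrightarrow> av (sum f I) < r"
  by (induction I rule: infinite_finite_induct) (auto intro: av_add_less)

lemma av_of_nat_le: "av (of_nat n) \<le> 1"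
  by (induction n) (auto intro: av_add_le)

lemma av_of_int_le: "av (of_int n) \<le> 1"
  by (cases n) (auto simp: av_of_nat_le simp del: of_nat_Suc)

end

sublocale padic_field \<subseteq> valued_field av
  by unfold_locales (fact av_nonneg av_eq_0_iff av_mult av_ultrametric)+

section \<open>Finiteness of the residue field\<close>

context padic_field
begin

lemma av_prime: "av (of_nat p) < 1" "p \<noteq> 0"
proof -
  show "p \<noteq> 0" using prime_p by auto
  have p: "prime (int p)" using prime_p by simp
  have "padic_abs p (of_int (int p)) = real p powi (- 1)"
    using prime_p p by (simp add: padic_abs_def prime_gt_0_nat)
  moreover have "av (of_nat p) = padic_abs p (of_int (int p))"
    using av_of_rat[of "of_int (int p)"] by simp
  ultimately have "av (of_nat p) = inverse (real p)" by (simp add: power_int_minus)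
  then show "av (of_nat p) < 1"
    using prime_gt_1_nat[OF prime_p] by (simp add: inverse_less_1_iff)
qed

lemma av_of_int_less_iff: "av (of_int n) < 1 \<longleftrightarrow> int p dvd n"
proof
  assume "int p dvd n"
  then obtain k where k: "n = int p * k" by blast
  show "av (of_int n) < 1"
    unfolding k of_int_mult of_int_of_nat_eq by (intro av_mult_less av_prime av_of_int_le)
next
  assume less: "av (of_int n) < 1"
  show "int p dvd n"
  proof (rule ccontr)
    assume ndvd: "\<not> int p dvd n"
    then have "av (of_int n) = 1"
      using av_of_rat[of "of_int n"]
      by (auto simp: padic_abs_def not_dvd_imp_multiplicity_0)
    with less show False by simp
  qed
qed

text \<open>Density gives a nearby fraction. Its denominator is prime to \<open>p\<close> because
  the fraction is integral, hence invertible modulo \<open>p\<close>, so the fraction is congruent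
  to an integer.\<close>

lemma integer_approximation:
  assumes "x \<in> Qp" "av x \<le> 1"
  shows "\<exists>k::int. av (x - of_int k) < 1"
proof -
  interpret M: Metric_space Qp "av_dist av"
  proof
    show "av_dist av x z \<le> av_dist av x y + av_dist av y z" for x y z
      using av_ultrametric[of "x - y" "y - z"] av_nonneg[of "x - y"] av_nonneg[of "y - z"]
      by (simp add: av_dist_def)
  qed (auto simp: av_dist_def av_nonneg intro: av_minus_commute)
  have "x \<in> M.mtopology closure_of \<rat>" using assms Rats_dense by simp
  then obtain y where y: "y \<in> \<rat>" "av (x - y) < 1"
    unfolding M.metric_closure_of by (auto simp: av_dist_def dest!: spec[of _ 1])
  obtain r where "y = of_rat r" using y(1) by (auto simp: Rats_def)
  moreover obtain a b :: int where ab: "r = of_int a / of_int b" "b > 0" "coprime a b"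
    using quotient_of_div quotient_of_denom_pos quotient_of_coprime by (metis surj_pair)
  ultimately have yab: "y = of_int a / of_int b" by (simp add: of_rat_divide)
  have avy: "av y \<le> 1"
    using av_diff_le[of x 1 "x - y"] y assms by simp
  have nb: "\<not> int p dvd b"
  proof
    assume "int p dvd b"
    moreover then have "\<not> int p dvd a"
      using ab(3) prime_p by (metis coprime_def not_prime_unit prime_nat_int_transfer)
    ultimately have "av (of_int b) < 1" "av (of_int a) \<ge> 1"
      using av_of_int_less_iff by (auto simp: not_less[symmetric])
    moreover have "av (of_int b) > 0" using ab by (intro av_pos) auto
    ultimately have "av y > 1" unfolding yab by (simp add: field_simps)
    then show False using avy by simp
  qed
  then have "coprime b (int p)" using prime_p
    by (metis coprime_commute prime_imp_coprime prime_nat_int_transfer)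
  then obtain c where c: "[b * c = 1] (mod int p)"
    using cong_solve_coprime_int by blast
  have "int p dvd a - b * (c * a)"
  proof -
    have "int p dvd (1 - b * c) * a"
      using c by (simp add: cong_iff_dvd_diff dvd_diff_commute)
    then show ?thesis by (simp add: algebra_simps)
  qed
  then have less: "av (of_int (a - b * (c * a))) < 1" using av_of_int_less_iff by blast
  have avb: "av (of_int b) = 1"
    using nb av_of_int_less_iff av_of_int_le[of b] by (metis linorder_not_less order_antisym)
  have "y - of_int (c * a) = of_int (a - b * (c * a)) / of_int b"
    using ab(2) by (simp add: yab field_simps)
  then have "av (y - of_int (c * a)) < 1" using less avb by simp
  then have "av (x - of_int (c * a)) < 1"
    using av_add_less[OF y(2), of "y - of_int (c * a)"] by simp
  then show ?thesis ..
qed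

text \<open>Linear independence of residue classes over the field with \<open>p\<close> elements,
  phrased with integer coefficients so that no quotient ring is formed.\<close>

definition residually_independent :: "'f set \<Rightarrow> bool" where
  "residually_independent A \<longleftrightarrow> finite A \<and> (\<forall>a\<in>A. av a \<le> 1) \<and>
    (\<forall>c. av (\<Sum>a\<in>A. of_int (c a) * a) < 1 \<longrightarrow> (\<forall>a\<in>A. int p dvd c a))"

text \<open>A dependence over \<open>Qp\<close>, divided by its largest coefficient and rounded to
  integers, becomes a dependence of residues with one coefficient congruent to \<open>1\<close>. So
  \<open>A\<close> is independent over \<open>Qp\<close> and cannot outnumber a spanning
  set.\<close>

lemma card_residually_independent:
  assumes A: "residually_independent A"
    and B: "finite B" "\<And>x. \<exists>c. (\<forall>b\<in>B. c b \<in> Qp) \<and> x = (\<Sum>b\<in>B. c b * b)"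
  shows "card A \<le> card B"
proof (rule ccontr)
  assume less: "\<not> card A \<le> card B"
  have fA: "finite A" using A by (simp add: residually_independent_def)
  obtain C where C: "\<And>x. (\<forall>b\<in>B. C x b \<in> Qp) \<and> x = (\<Sum>b\<in>B. C x b * b)"
    using B(2) by metis
  have "\<exists>c. (\<forall>a\<in>A. c a \<in> Qp) \<and> (\<exists>a\<in>A. c a \<noteq> 0) \<and> (\<forall>b\<in>B. (\<Sum>a\<in>A. C a b * c a) = 0)"
    by (rule homogeneous_system_solvable)
      (use Qp_1 Qp_diff Qp_mult Qp_inverse B(1) fA less C in auto)
  then obtain c where c: "\<forall>a\<in>A. c a \<in> Qp" "\<exists>a\<in>A. c a \<noteq> 0"
      "\<forall>b\<in>B. (\<Sum>a\<in>A. C a b * c a) = 0" by blast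
  have rel: "(\<Sum>a\<in>A. c a * a) = 0"
  proof -
    have "(\<Sum>a\<in>A. c a * a) = (\<Sum>a\<in>A. \<Sum>b\<in>B. C a b * c a * b)"
    proof (intro sum.cong refl)
      fix a
      have "c a * a = c a * (\<Sum>b\<in>B. C a b * b)" using C by metis
      then show "c a * a = (\<Sum>b\<in>B. C a b * c a * b)"
        by (simp add: sum_distrib_left mult_ac)
    qed
    also have "\<dots> = (\<Sum>b\<in>B. (\<Sum>a\<in>A. C a b * c a) * b)"
      by (subst sum.swap) (simp add: sum_distrib_right)
    finally show ?thesis using c by simp
  qed
  have "A \<noteq> {}" using c by auto
  then have "Max ((\<lambda>a. av (c a)) ` A) \<in> (\<lambda>a. av (c a)) ` A" using fA by (intro Max_in) auto
  then obtain m where m: "m \<in> A" "av (c m) = Max ((\<lambda>a. av (c a)) ` A)" by auto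
  then have m: "m \<in> A" "\<And>a. a \<in> A \<Longrightarrow> av (c a) \<le> av (c m)" using fA by auto
  have cm: "c m \<noteq> 0" using c(2) m av_pos by (metis av_eq_0_iff av_nonneg order_antisym)
  define d where "d a = c a * inverse (c m)" for a
  have d: "d a \<in> Qp" "av (d a) \<le> 1" if "a \<in> A" for a
    using that c(1) m av_pos[OF cm] Qp_mult[OF _ Qp_inverse, of "c a" "c m"]
    by (auto simp: d_def divide_le_eq_1 divide_inverse[symmetric])
  have "\<exists>k::int. a \<in> A \<longrightarrow> av (d a - of_int k) < 1" for a
    using integer_approximation d by (cases "a \<in> A") auto
  then obtain k :: "'f \<Rightarrow> int" where k: "\<And>a. a \<in> A \<Longrightarrow> av (d a - of_int (k a)) < 1"
    by metis
  have "(\<Sum>a\<in>A. d a * a) = inverse (c m) * (\<Sum>a\<in>A. c a * a)"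
    by (simp add: d_def sum_distrib_left mult_ac)
  then have "(\<Sum>a\<in>A. d a * a) = 0" unfolding rel by simp
  then have "(\<Sum>a\<in>A. of_int (k a) * a) = - (\<Sum>a\<in>A. (d a - of_int (k a)) * a)"
    unfolding left_diff_distrib sum_subtractf by simp
  moreover have "av (\<Sum>a\<in>A. (d a - of_int (k a)) * a) < 1"
    using k A by (intro av_sum_less av_mult_less) (auto simp: residually_independent_def)
  ultimately have "av (\<Sum>a\<in>A. of_int (k a) * a) < 1" by simp
  then have "int p dvd k m" using A m(1) by (auto simp: residually_independent_def)
  then have "av (of_int (k m)) < 1" using av_of_int_less_iff by blast
  then have "av (d m) < 1" using av_add_less[OF k[OF m(1)]] by fastforce
  then show False using cm by (simp add: d_def)
qed

text \<open>A residually independent set of maximal size spans the residue field over the prime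
  field, so its combinations with coefficients in \<open>{0..<int p}\<close> meet every
  class.\<close>

lemma finite_residue_field:
  "\<exists>T. finite T \<and> (\<forall>x. av x \<le> 1 \<longrightarrow> (\<exists>t\<in>T. av (x - t) < 1))"
proof -
  obtain B where B: "finite B" "\<And>x. \<exists>c. (\<forall>b\<in>B. c b \<in> Qp) \<and> x = (\<Sum>b\<in>B. c b * b)"
    using finite_extension by metis
  let ?P = "\<lambda>n. \<exists>A. residually_independent A \<and> card A = n"
  have "?P 0" by (intro exI[of _ "{}"]) (simp add: residually_independent_def)
  moreover have "n \<le> card B" if "?P n" for n
    using that card_residually_independent[OF _ B] by blast
  ultimately obtain n where n: "?P n" "\<And>m. ?P m \<Longrightarrow> m \<le> n"
    using Greatest_le_nat[of ?P _ "card B"] GreatestI_nat[of ?P 0 "card B"] by blast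
  then obtain A where A: "residually_independent A" "card A = n" by blast
  then have fA: "finite A" by (simp add: residually_independent_def)
  define T where "T = (\<lambda>c. \<Sum>a\<in>A. of_int (c a) * a) ` (A \<rightarrow>\<^sub>E {0..<int p})"
  have "\<exists>t\<in>T. av (x - t) < 1" if x: "av x \<le> 1" for x
  proof -
    have avA: "av a \<le> 1" if "a \<in> A" for a using A that by (simp add: residually_independent_def)
    \<comment> \<open>Maximality of \<open>A\<close>: modulo the maximal ideal \<open>x\<close>
      satisfies a relation with \<open>A\<close> in which its own coefficient \<open>d\<close> is
      invertible modulo \<open>p\<close>.\<close>
    obtain c d where cd: "av (of_int d * x + (\<Sum>a\<in>A. of_int (c a) * a)) < 1" "\<not> int p dvd d"
    proof (cases "x \<in> A")
      case True
      have "(\<Sum>a\<in>A. of_int (if a = x then -1 else 0) * a) = (\<Sum>a\<in>A. if a = x then - x else 0)"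
        by (intro sum.cong) auto
      also have "\<dots> = - x" using True fA by simp
      finally have "av (of_int 1 * x + (\<Sum>a\<in>A. of_int (if a = x then -1 else 0) * a)) < 1"
        by simp
      moreover have "\<not> int p dvd 1" using prime_p by (metis not_prime_unit prime_nat_int_transfer)
      ultimately show ?thesis by (rule that)
    next
      case False
      have "\<not> residually_independent (insert x A)"
      proof
        assume "residually_independent (insert x A)"
        then have "card (insert x A) \<le> n" using n(2) by blast
        with False fA A(2) show False by simp
      qed
      then obtain c where c: "av (\<Sum>a\<in>insert x A. of_int (c a) * a) < 1"
          "\<exists>a\<in>insert x A. \<not> int p dvd c a"
        using fA avA x by (auto simp: residually_independent_def)
      have c': "av (of_int (c x) * x + (\<Sum>a\<in>A. of_int (c a) * a)) < 1"
        using c(1) False fA by simp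
      have "\<not> int p dvd c x"
      proof
        assume dvd: "int p dvd c x"
        then have "av (of_int (c x) * x) < 1"
          using av_of_int_less_iff x by (blast intro: av_mult_less)
        then have "av (\<Sum>a\<in>A. of_int (c a) * a) < 1"
          using av_diff_less[OF c'] by fastforce
        then show False using A(1) dvd c(2) by (auto simp: residually_independent_def)
      qed
      then show ?thesis using that c' by blast
    qed
    have "coprime d (int p)" using cd(2) prime_p
      by (metis coprime_commute prime_imp_coprime prime_nat_int_transfer)
    then obtain e where "[d * e = 1] (mod int p)"
      using cong_solve_coprime_int by blast
    then have "int p dvd 1 - d * e" by (simp add: cong_iff_dvd_diff dvd_diff_commute)
    then have e: "av (of_int (1 - d * e)) < 1" using av_of_int_less_iff by blast
    define k where "k = (\<lambda>a\<in>A. (- (e * c a)) mod int p)"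
    let ?t = "\<Sum>a\<in>A. of_int (k a) * a"
    have "k \<in> A \<rightarrow>\<^sub>E {0..<int p}" using av_prime(2) by (auto simp: k_def)
    then have t: "?t \<in> T" by (auto simp: T_def)
    have "?t - (\<Sum>a\<in>A. of_int (- (e * c a)) * a) = (\<Sum>a\<in>A. of_int (k a - (- (e * c a))) * a)"
      unfolding of_int_diff left_diff_distrib sum_subtractf ..
    also have "av \<dots> < 1"
    proof (intro av_sum_less av_mult_less avA)
      fix a assume "a \<in> A"
      then have "int p dvd k a - (- (e * c a))"
        by (simp add: k_def) (metis dvd_minus_mod dvd_diff_commute minus_diff_eq add.inverse_inverse diff_minus_eq_add)
      then show "av (of_int (k a - (- (e * c a)))) < 1" using av_of_int_less_iff by blast
    qed auto
    finally have 1: "av (?t - (\<Sum>a\<in>A. of_int (- (e * c a)) * a)) < 1" .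
    have 2: "av (of_int (1 - d * e) * x) < 1" using e x by (rule av_mult_less)
    have 3: "av ((of_int d * x + (\<Sum>a\<in>A. of_int (c a) * a)) * of_int e) < 1"
      using cd(1) av_of_int_le by (rule av_mult_less)
    have 4: "(\<Sum>a\<in>A. of_int (- (e * c a)) * a) = - (of_int e * (\<Sum>a\<in>A. of_int (c a) * a))"
      by (simp add: sum_distrib_left sum_negf mult_ac)
    have eq: "x - ?t = of_int (1 - d * e) * x + (of_int d * x + (\<Sum>a\<in>A. of_int (c a) * a)) * of_int e
        - (?t - (\<Sum>a\<in>A. of_int (- (e * c a)) * a))"
      unfolding 4 by (simp add: algebra_simps)
    have "av (x - ?t) < 1" unfolding eq by (rule av_diff_less[OF av_add_less[OF 2 3] 1])
    then show ?thesis using t by blast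
  qed
  moreover have "finite T" unfolding T_def using fA by (intro finite_imageI finite_PiE) auto
  ultimately show ?thesis by blast
qed

lemma residue_representatives:
  obtains R where "finite R" "0 \<in> R" "\<And>r. r \<in> R \<Longrightarrow> av r \<le> 1"
    "\<And>x. av x \<le> 1 \<Longrightarrow> \<exists>r\<in>R. av (x - r) < 1"
    "\<And>r s. r \<in> R \<Longrightarrow> s \<in> R \<Longrightarrow> av (r - s) < 1 \<Longrightarrow> r = s"
proof -
  obtain T where T: "finite T" "\<And>x. av x \<le> 1 \<Longrightarrow> \<exists>t\<in>T. av (x - t) < 1"
    using finite_residue_field by blast
  \<comment> \<open>The maximal ideal gets the representative \<open>0\<close> itself, since sums
    over \<open>R\<close> will single out the term at \<open>0\<close>.\<close>
  define rep where "rep x = (if av x < 1 then 0 else SOME t. t \<in> T \<and> av (x - t) < 1)" for x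
  have rep: "av (x - rep x) < 1" "rep x \<in> insert 0 T" if x: "av x \<le> 1" for x
  proof -
    have "\<exists>t. t \<in> T \<and> av (x - t) < 1" using T(2)[OF x] by blast
    from someI_ex[OF this] show "av (x - rep x) < 1" "rep x \<in> insert 0 T"
      by (auto simp: rep_def)
  qed
  have cong: "rep x = rep y" if "av (x - y) < 1" for x y
  proof -
    have "av (x - t) < 1 \<longleftrightarrow> av (y - t) < 1" for t
      using av_add_less[OF that, of "y - t"] av_diff_less[of "x - t" 1 "x - y"] that by auto
    from this[of 0] this show ?thesis by (simp add: rep_def)
  qed
  let ?R = "rep ` {x. av x \<le> 1}"
  have "?R \<subseteq> insert 0 T" using rep(2) by blast
  then have "finite ?R" by (rule finite_subset) (simp add: T(1))
  moreover have "0 \<in> ?R" by (intro image_eqI[of _ _ 0]) (auto simp: rep_def)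
  moreover have "av r \<le> 1" if "r \<in> ?R" for r
    using that rep(1) av_diff_le[of x 1 "x - rep x" for x] by force
  moreover have "\<exists>r\<in>?R. av (x - r) < 1" if "av x \<le> 1" for x
    using that rep(1) by blast
  moreover have "r = s" if "r \<in> ?R" "s \<in> ?R" "av (r - s) < 1" for r s
  proof -
    from that(1,2) obtain x y where xy: "r = rep x" "s = rep y" "av x \<le> 1" "av y \<le> 1"
      by blast
    have "av (x - rep x + (r - s) - (y - rep y)) < 1"
      using rep(1) xy(3,4) that(3) by (intro av_diff_less[OF av_add_less])
    then have "av (x - y) < 1" by (simp add: xy)
    then show ?thesis using cong xy by simp
  qed
  ultimately show thesis by (rule that)
qed

end

text \<open>\<open>R\<close> represents the residue field. For \<open>\<pi> = 0\<close> the
  predicate \<open>uniformizer\<close> would describe a trivial absolute value;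
  \<open>pi_nonzero\<close> excludes this.\<close>

locale discretely_valued_field = valued_field av for av :: "'f::field \<Rightarrow> real" +
  fixes \<pi> :: 'f and R :: "'f set"
  assumes uniformizer: "uniformizer av \<pi>" and pi_nonzero [simp]: "\<pi> \<noteq> 0"
    and finite_R: "finite R" and zero_R: "0 \<in> R"
    and R_integral: "r \<in> R \<Longrightarrow> av r \<le> 1"
    and R_exhaustive: "av x \<le> 1 \<Longrightarrow> \<exists>r\<in>R. av (x - r) < 1"
    and R_separated: "r \<in> R \<Longrightarrow> s \<in> R \<Longrightarrow> av (r - s) < 1 \<Longrightarrow> r = s"
begin

lemma av_less_one_iff: "av x < 1 \<longleftrightarrow> av x \<le> av \<pi>"
proof -
  have "av x < 1 \<longleftrightarrow> (\<exists>y. x = \<pi> * y \<and> av y \<le> 1)"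
    using uniformizer unfolding uniformizer_def integers_def by blast
  also have "\<dots> \<longleftrightarrow> av (x / \<pi>) \<le> 1"
    by (metis nonzero_mult_div_cancel_left nonzero_eq_divide_eq pi_nonzero mult.commute)
  also have "\<dots> \<longleftrightarrow> av x \<le> av \<pi>" using av_pos[OF pi_nonzero] by (simp add: divide_le_eq_1)
  finally show ?thesis .
qed

lemma av_pi: "0 < av \<pi>" "av \<pi> < 1"
  using av_pos av_less_one_iff by auto

lemma cong_zero_iff: "cong_zero av \<pi> n x \<longleftrightarrow> av x \<le> av \<pi> ^ n"
proof -
  have "cong_zero av \<pi> n x \<longleftrightarrow> av (x / \<pi> ^ n) \<le> 1"
    unfolding cong_zero_def integers_def image_iff
    by (metis mem_Collect_eq nonzero_mult_div_cancel_left nonzero_eq_divide_eq pi_nonzero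
        power_not_zero mult.commute)
  also have "\<dots> \<longleftrightarrow> av x \<le> av \<pi> ^ n" using av_pi by (simp add: divide_le_eq_1)
  finally show ?thesis .
qed

lemma obtain_valuation:
  assumes "x \<noteq> 0"
  obtains m u where "av u = 1" "x = \<pi> powi m * u"
proof -
  have int: "\<exists>m u. av u = 1 \<and> x = \<pi> powi m * u" if x: "x \<noteq> 0" "av x \<le> 1" for x
  proof -
    obtain n where n: "av \<pi> ^ n < av x"
      using real_arch_pow_inv[OF av_pos[OF x(1)] av_pi(2)] by blast
    then show ?thesis using x
    proof (induction n arbitrary: x)
      case 0
      then show ?case by simp
    next
      case (Suc n)
      show ?case
      proof (cases "av x < 1")
        case True
        have "\<exists>m u. av u = 1 \<and> x / \<pi> = \<pi> powi m * u"
          using Suc.prems True av_pi av_less_one_iff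
          by (intro Suc.IH) (auto simp: field_simps)
        then obtain m u where "av u = 1" "x / \<pi> = \<pi> powi m * u" by blast
        then have "av u = 1" "x = \<pi> powi (m + 1) * u"
          by (auto simp: power_int_add field_simps)
        then show ?thesis by blast
      next
        case False
        then have "av x = 1 \<and> x = \<pi> powi 0 * x" using Suc.prems by simp
        then show ?thesis by blast
      qed
    qed
  qed
  show thesis
  proof (cases "av x \<le> 1")
    case True
    then show ?thesis using int assms that by blast
  next
    case False
    then have "av (inverse x) \<le> 1" by (simp add: inverse_le_1_iff)
    then obtain m u where mu: "av u = 1" "inverse x = \<pi> powi m * u"
      using int[of "inverse x"] assms by auto
    then have "x = inverse (\<pi> powi m * u)" by (metis inverse_inverse_eq)
    then have "x = \<pi> powi (- m) * inverse u" by (simp add: power_int_minus)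
    then show ?thesis by (rule that[rotated]) (simp add: mu)
  qed
qed

lemma card_R: "2 \<le> card R"
proof -
  obtain r where r: "r \<in> R" "av (1 - r) < 1" using R_exhaustive[of 1] by auto
  then have "{0, r} \<subseteq> R" "r \<noteq> 0" using zero_R by auto
  then show ?thesis using card_mono[OF finite_R, of "{0, r}"] by simp
qed

end

section \<open>Two by two matrices\<close>

lemma mat2_nth [simp]:
  "mat2 a b c d $ 1 $ 1 = a" "mat2 a b c d $ 1 $ 2 = b"
  "mat2 a b c d $ 2 $ 1 = c" "mat2 a b c d $ 2 $ 2 = d"
  by (simp_all add: mat2_def)

lemma mat2_eqI:
  fixes g h :: "'f::zero mat2"
  assumes "g $ 1 $ 1 = h $ 1 $ 1" "g $ 1 $ 2 = h $ 1 $ 2"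
    "g $ 2 $ 1 = h $ 2 $ 1" "g $ 2 $ 2 = h $ 2 $ 2"
  shows "g = h"
  using assms by (simp add: vec_eq_iff forall_2)

lemma mat2_cases:
  obtains a b c d where "g = mat2 a b c d"
proof
  show "g = mat2 (g $ 1 $ 1) (g $ 1 $ 2) (g $ 2 $ 1) (g $ 2 $ 2)" by (rule mat2_eqI) auto
qed

lemma mat2_mult:
  fixes a b c d :: "'f::field"
  shows "mat2 a b c d ** mat2 a' b' c' d'
    = mat2 (a * a' + b * c') (a * b' + b * d') (c * a' + d * c') (c * b' + d * d')"
  by (rule mat2_eqI) (simp_all add: matrix_matrix_mult_def sum_2)

lemma det_mat2: "det (mat2 a b c d) = a * d - b * (c :: 'f::field)"
  by (simp add: det_2)

lemma mat_eq_mat2: "mat z = mat2 z 0 0 (z :: 'f::field)"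
  by (rule mat2_eqI) (simp_all add: mat_def)

lemma mat2_in_GL2_iff: "mat2 a b c d \<in> carrier GL2 \<longleftrightarrow> a * d \<noteq> b * (c :: 'f::field)"
  by (simp add: GL2_def invertible_det_nz det_mat2)

lemma GL2_cases:
  assumes "g \<in> carrier GL2"
  obtains a b c d :: "'f::field" where "g = mat2 a b c d" "a * d \<noteq> b * c"
  using assms mat2_cases[of g] mat2_in_GL2_iff by metis

lemma GL2_one: "mat 1 \<in> carrier GL2"
  by (simp add: mat_eq_mat2 mat2_in_GL2_iff)

lemma GL2_mult: "g \<in> carrier GL2 \<Longrightarrow> h \<in> carrier GL2 \<Longrightarrow> g ** h \<in> carrier (GL2 :: 'f::field mat2 monoid)"
  by (simp add: GL2_def invertible_mult)

lemma GL2_inverse: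
  assumes "g \<in> carrier (GL2 :: 'f::field mat2 monoid)"
  shows "matrix_inv g \<in> carrier GL2" "matrix_inv g ** g = mat 1" "g ** matrix_inv g = mat 1"
proof -
  have "g ** matrix_inv g = mat 1 \<and> matrix_inv g ** g = mat 1"
    using assms someI_ex[of "\<lambda>h. g ** h = mat 1 \<and> h ** g = mat 1"]
    unfolding GL2_def invertible_def matrix_inv_def by simp
  then show "matrix_inv g \<in> carrier GL2" "matrix_inv g ** g = mat 1" "g ** matrix_inv g = mat 1"
    unfolding GL2_def invertible_def by auto
qed

lemma matrix_inv_eqI:
  assumes "g \<in> carrier (GL2 :: 'f::field mat2 monoid)" "g ** h = mat 1"
  shows "matrix_inv g = h"
  using GL2_inverse(2)[OF assms(1)] assms(2) by (metis matrix_mul_assoc matrix_mul_lid matrix_mul_rid)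

context discretely_valued_field
begin

lemma mat2_in_GL2_integers_iff: "mat2 a b c d \<in> GL2_integers av \<longleftrightarrow>
    av a \<le> 1 \<and> av b \<le> 1 \<and> av c \<le> 1 \<and> av d \<le> 1 \<and> av (a * d - b * c) = 1"
  by (auto simp: GL2_integers_def forall_2 integers_def det_mat2)

lemma mat2_in_Gamma0_iff: "mat2 a b c d \<in> Gamma0 av \<pi> \<longleftrightarrow>
    av a \<le> 1 \<and> av b \<le> 1 \<and> av c < 1 \<and> av d \<le> 1 \<and> av (a * d - b * c) = 1"
  using cong_zero_iff[of 1 c] av_less_one_iff[of c] av_pi
  by (auto simp: Gamma0_def mat2_in_GL2_integers_iff)

lemma GL2_integers_subset: "GL2_integers av \<subseteq> carrier GL2"
proof
  fix g assume "g \<in> GL2_integers av"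
  then show "g \<in> carrier GL2"
    by (cases g rule: mat2_cases) (auto simp: mat2_in_GL2_integers_iff mat2_in_GL2_iff)
qed

lemma Gamma1_0: "Gamma1 av \<pi> 0 = GL2_integers av"
proof -
  have "cong_zero av \<pi> 0 (g $ 2 $ 1)" "cong_zero av \<pi> 0 (g $ 2 $ 2 - 1)"
    if "g \<in> GL2_integers av" for g
    using that by (auto simp: cong_zero_iff GL2_integers_def integers_def intro: av_diff_le)
  then show ?thesis by (auto simp: Gamma1_def)
qed

text \<open>On residue classes \<open>f\<close> is an injective self-map of the finite set
  \<open>A\<close>, hence a permutation, so summing along it changes nothing.\<close>

lemma sum_representatives:
  fixes F G :: "'f \<Rightarrow> 'a::comm_monoid_add"
  assumes "A \<subseteq> R"
    and f: "\<And>u. u \<in> A \<Longrightarrow> av (f u) \<le> 1"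
      "\<And>u r. u \<in> A \<Longrightarrow> r \<in> R \<Longrightarrow> av (f u - r) < 1 \<Longrightarrow> r \<in> A"
      "\<And>u v. u \<in> A \<Longrightarrow> v \<in> A \<Longrightarrow> av (f u - f v) < 1 \<Longrightarrow> u = v"
    and "\<And>u r. u \<in> A \<Longrightarrow> r \<in> R \<Longrightarrow> av (f u - r) < 1 \<Longrightarrow> G u = F r"
  shows "sum G A = sum F A"
proof -
  have finA: "finite A" using \<open>A \<subseteq> R\<close> finite_R by (rule finite_subset)
  have "\<exists>r. u \<in> A \<longrightarrow> r \<in> R \<and> av (f u - r) < 1" for u
    using f(1) R_exhaustive by blast
  then obtain s where s: "\<And>u. u \<in> A \<Longrightarrow> s u \<in> R \<and> av (f u - s u) < 1" by metis
  have inj: "inj_on s A"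
  proof
    fix u v assume uv: "u \<in> A" "v \<in> A" "s u = s v"
    have "av ((f u - s u) - (f v - s v)) < 1"
      by (rule av_diff_less) (use s uv(1,2) in auto)
    then show "u = v" using uv f(3) by simp
  qed
  have "s ` A \<subseteq> A" using s f(2) by blast
  then have img: "s ` A = A" using inj finA by (intro card_subset_eq) (auto simp: card_image)
  have "sum G A = (\<Sum>u\<in>A. F (s u))" using s assms(5) by (intro sum.cong) auto
  also have "\<dots> = sum F A" using sum.reindex[OF inj, of F] img by simp
  finally show ?thesis .
qed

end

section \<open>Representations: linearity, generation by one vector, trace to the maximal compact
  subgroup\<close>

lemma (in GL2_rep) rep_add: "g \<in> carrier GL2 \<Longrightarrow> \<rho> g (v + w) = \<rho> g v + \<rho> g w"
  using rep_linear by (simp add: Vector_Spaces.linear_iff)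

lemma (in GL2_rep) rep_scale: "g \<in> carrier GL2 \<Longrightarrow> \<rho> g (sc c v) = sc c (\<rho> g v)"
  using rep_linear by (simp add: Vector_Spaces.linear_iff)

lemma (in GL2_rep) rep_zero: "g \<in> carrier GL2 \<Longrightarrow> \<rho> g 0 = 0"
  using rep_add[of g 0 0] by simp

lemma (in GL2_rep) rep_sum:
  "g \<in> carrier GL2 \<Longrightarrow> \<rho> g (sum f A) = (\<Sum>a\<in>A. \<rho> g (f a))"
  by (induction A rule: infinite_finite_induct) (auto simp: rep_zero rep_add)

lemma (in GL2_rep) rep_inverse_cancel:
  assumes "g \<in> carrier GL2"
  shows "\<rho> (matrix_inv g) (\<rho> g v) = v" "\<rho> g (\<rho> (matrix_inv g) v) = v"
  using GL2_inverse[OF assms] assms by (simp_all add: rep_one flip: rep_mult)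

lemma (in GL2_rep) rep_eq_0_iff: "g \<in> carrier GL2 \<Longrightarrow> \<rho> g v = 0 \<longleftrightarrow> v = 0"
  using rep_inverse_cancel(1)[of g v] by (auto simp: rep_zero GL2_inverse)

lemma (in GL2_rep) rep_mat2_mult:
  assumes "a * d \<noteq> b * c" "a' * d' \<noteq> b' * c'"
  shows "\<rho> (mat2 a b c d) (\<rho> (mat2 a' b' c' d') v)
    = \<rho> (mat2 (a * a' + b * c') (a * b' + b * d') (c * a' + d * c') (c * b' + d * d')) v"
  using assms rep_mult[of "mat2 a b c d" "mat2 a' b' c' d'"] by (simp add: mat2_mult mat2_in_GL2_iff)

text \<open>The vectors all of whose translates satisfy \<open>P\<close> form an invariant subspace
  containing \<open>v\<close>. This extends vanishing from the orbit of one vector to the whole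
  space.\<close>

lemma (in GL2_rep) irreducible_generates:
  assumes irr: "irreducible_rep sc \<rho>"
    and zero: "P 0" and add: "\<And>x y. P x \<Longrightarrow> P y \<Longrightarrow> P (x + y)" and scale: "\<And>c x. P x \<Longrightarrow> P (sc c x)"
    and v: "v \<noteq> 0" and gen: "\<And>g. g \<in> carrier GL2 \<Longrightarrow> P (\<rho> g v)"
  shows "P x"
proof -
  let ?W = "{x. \<forall>g\<in>carrier GL2. P (\<rho> g x)}"
  have "subspace ?W"
    unfolding subspace_def using zero add scale by (auto simp: rep_zero rep_add rep_scale)
  moreover have "\<rho> h ` ?W \<subseteq> ?W" if "h \<in> carrier GL2" for h
    using that by (auto simp: GL2_mult simp flip: rep_mult)
  moreover have "v \<in> ?W" using gen by blast
  ultimately have "?W = UNIV" using irr v unfolding irreducible_rep_def by blast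
  then have "P (\<rho> (mat 1) x)" using GL2_one by blast
  then show ?thesis by (simp add: rep_one)
qed

locale padic_rep = discretely_valued_field av \<pi> R + GL2_rep sc \<rho>
  for av :: "'f::field \<Rightarrow> real" and \<pi> R
    and sc :: "complex \<Rightarrow> 'v::ab_group_add \<Rightarrow> 'v" and \<rho> :: "'f mat2 \<Rightarrow> 'v \<Rightarrow> 'v"
begin

lemma fixed_GL2_integers:
  assumes "v \<in> fixed_vectors \<rho> (GL2_integers av)"
    and "av a \<le> 1" "av b \<le> 1" "av c \<le> 1" "av d \<le> 1" "av (a * d - b * c) = 1"
  shows "\<rho> (mat2 a b c d) v = v"
  using assms by (auto simp: fixed_vectors_def mat2_in_GL2_integers_iff)

lemma fixed_Gamma0:
  assumes "v \<in> fixed_vectors \<rho> (Gamma0 av \<pi>)"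
    and "av a \<le> 1" "av b \<le> 1" "av c < 1" "av d \<le> 1" "av (a * d - b * c) = 1"
  shows "\<rho> (mat2 a b c d) v = v"
  using assms by (auto simp: fixed_vectors_def mat2_in_Gamma0_iff)

text \<open>
  The matrices \<open>1\<close> and \<open>mat2 u 1 1 0\<close> represent the cosets of \<open>Gamma0\<close> in the maximal compact
  subgroup, so this is the trace map; invariance is checked on generators of the latter.
\<close>

lemma trace_fixed:
  assumes v: "v \<in> fixed_vectors \<rho> (Gamma0 av \<pi>)"
  shows "v + (\<Sum>u\<in>R. \<rho> (mat2 u 1 1 0) v) \<in> fixed_vectors \<rho> (GL2_integers av)"
proof -
  let ?s = "v + (\<Sum>u\<in>R. \<rho> (mat2 u 1 1 0) v)"
  \<comment> \<open>Upper triangular elements fix the coset of \<open>1\<close> and send that of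
    \<open>u\<close> to that of \<open>(a * u + b) / d\<close>.\<close>
  have upper: "\<rho> (mat2 a b 0 d) ?s = ?s" if "av a = 1" "av b \<le> 1" "av d = 1" for a b d
  proof -
    have nz: "a \<noteq> 0" "d \<noteq> 0" using that by auto
    have "\<rho> (mat2 a b 0 d) (\<rho> (mat2 u 1 1 0) v) = \<rho> (mat2 r 1 1 0) v"
      if ur: "u \<in> R" "r \<in> R" "av ((a * u + b) / d - r) < 1" for u r
    proof -
      define x where "x = (a * u + b) / d - r"
      have eq: "a * u + b = r * d + x * d" using nz by (simp add: x_def field_simps)
      have "\<rho> (mat2 d 0 (x * d) a) v = v"
        by (rule fixed_Gamma0[OF v]) (use \<open>av a = 1\<close> \<open>av d = 1\<close> ur in \<open>auto simp: x_def\<close>)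
      then have "\<rho> (mat2 r 1 1 0) v = \<rho> (mat2 r 1 1 0) (\<rho> (mat2 d 0 (x * d) a) v)"
        by simp
      also have "\<dots> = \<rho> (mat2 a b 0 d) (\<rho> (mat2 u 1 1 0) v)"
        using nz by (simp add: rep_mat2_mult eq)
      finally show ?thesis ..
    qed
    moreover have "av ((a * u + b) / d) \<le> 1" if "u \<in> R" for u
      using that \<open>av a = 1\<close> \<open>av d = 1\<close> \<open>av b \<le> 1\<close> R_integral by (simp add: av_add_le)
    moreover have "u = u'" if "u \<in> R" "u' \<in> R" "av ((a * u + b) / d - (a * u' + b) / d) < 1" for u u'
    proof -
      have "(a * u + b) / d - (a * u' + b) / d = a / d * (u - u')" by (simp add: field_simps nz)
      then show ?thesis using that \<open>av a = 1\<close> \<open>av d = 1\<close> R_separated by simp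
    qed
    ultimately have "(\<Sum>u\<in>R. \<rho> (mat2 a b 0 d) (\<rho> (mat2 u 1 1 0) v)) = (\<Sum>u\<in>R. \<rho> (mat2 u 1 1 0) v)"
      by (intro sum_representatives[where f = "\<lambda>u. (a * u + b) / d"]) auto
    moreover have "\<rho> (mat2 a b 0 d) v = v" using that by (intro fixed_Gamma0[OF v]) auto
    ultimately show ?thesis using nz by (simp add: rep_add rep_sum mat2_in_GL2_iff)
  qed
  \<comment> \<open>The representative at \<open>u = 0\<close> is the swap itself, so the swap
    exchanges the cosets of \<open>1\<close> and of \<open>u = 0\<close>; on the remaining ones it
    acts by inverting \<open>u\<close>.\<close>
  have swap: "\<rho> (mat2 0 1 1 0) ?s = ?s"
  proof -
    let ?J = "mat2 0 1 1 0"
    have unit: "av u = 1" if "u \<in> R - {0}" for u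
    proof -
      have "\<not> av (u - 0) < 1" using that R_separated[of u 0] zero_R by blast
      then show ?thesis using that R_integral[of u] by auto
    qed
    have 1: "\<rho> ?J (\<rho> (mat2 u 1 1 0) v) = \<rho> (mat2 r 1 1 0) v"
      if ur: "u \<in> R - {0}" "r \<in> R" "av (inverse u - r) < 1" for u r
    proof -
      define x where "x = inverse u - r"
      have r: "r = inverse u - x" by (simp add: x_def)
      have avr: "av r \<le> 1" using ur R_integral by blast
      have nz: "u \<noteq> 0" using ur by auto
      have "\<rho> (mat2 u 1 (x * u) (- r)) v = v"
      proof (rule fixed_Gamma0[OF v])
        have "u * - r - 1 * (x * u) = -1" using nz by (simp add: r algebra_simps)
        then show "av (u * - r - 1 * (x * u)) = 1" by simp
      qed (use unit[OF ur(1)] ur avr in \<open>auto simp: x_def\<close>)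
      then have "\<rho> (mat2 r 1 1 0) v = \<rho> (mat2 r 1 1 0) (\<rho> (mat2 u 1 (x * u) (- r)) v)"
        by simp
      also have "\<dots> = \<rho> ?J (\<rho> (mat2 u 1 1 0) v)"
        using nz by (simp add: rep_mat2_mult r algebra_simps)
      finally show ?thesis ..
    qed
    have 2: "u = u'"
      if uu: "u \<in> R - {0}" "u' \<in> R - {0}" "av (inverse u - inverse u') < 1" for u u'
    proof -
      have "inverse u - inverse u' = (u' - u) / (u * u')" using uu by (simp add: field_simps)
      then have "av (u' - u) < 1" using unit[OF uu(1)] unit[OF uu(2)] uu(3) by simp
      then show ?thesis using R_separated uu by blast
    qed
    have 3: "r \<in> R - {0}" if "u \<in> R - {0}" "r \<in> R" "av (inverse u - r) < 1" for u r
      using that unit[of u] by auto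
    have "(\<Sum>u\<in>R - {0}. \<rho> ?J (\<rho> (mat2 u 1 1 0) v)) = (\<Sum>u\<in>R - {0}. \<rho> (mat2 u 1 1 0) v)"
    proof (rule sum_representatives[where f = inverse])
      show "av (inverse u) \<le> 1" if "u \<in> R - {0}" for u using unit[OF that] by simp
    qed (use 1 2 3 in blast)+
    moreover have "?s = v + \<rho> ?J v + (\<Sum>u\<in>R - {0}. \<rho> (mat2 u 1 1 0) v)"
      using sum.remove[OF finite_R zero_R, of "\<lambda>u. \<rho> (mat2 u 1 1 0) v"] by (simp add: add.assoc)
    moreover have "\<rho> ?J (\<rho> ?J v) = v"
      by (simp add: rep_mat2_mult rep_one flip: mat_eq_mat2)
    ultimately show ?thesis by (simp add: rep_add rep_sum mat2_in_GL2_iff add.commute)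
  qed
  \<comment> \<open>A unit in the lower left corner puts the matrix in the big Bruhat cell, where it
    is a product of the swap and integral upper triangular matrices.\<close>
  have bruhat: "\<rho> (mat2 a b c d) ?s = ?s"
    if k: "mat2 a b c d \<in> GL2_integers av" and c: "av c = 1" for a b c d
  proof -
    have nz: "c \<noteq> 0" using c by auto
    have integral: "av a \<le> 1" "av d \<le> 1" and det: "av (a * d - b * c) = 1"
      using k by (auto simp: mat2_in_GL2_integers_iff)
    let ?e = "- (a * d - b * c) / c"
    have "?e \<noteq> 0" using nz det by auto
    have "av ?e = 1" by (simp only: av_divide av_uminus det c div_by_1)
    have "\<rho> (mat2 a b c d) ?s
        = \<rho> (mat2 1 (a / c) 0 1) (\<rho> (mat2 0 1 1 0) (\<rho> (mat2 c d 0 ?e) ?s))"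
      using nz \<open>?e \<noteq> 0\<close> by (simp add: rep_mat2_mult) (simp add: field_simps)
    also have "\<dots> = ?s"
      using integral c \<open>av ?e = 1\<close> by (simp add: upper swap del: minus_diff_eq)
    finally show ?thesis .
  qed
  have "\<rho> k ?s = ?s" if k: "k \<in> GL2_integers av" for k
  proof (cases k rule: mat2_cases)
    case (1 a b c d)
    note k = k[unfolded 1]
    show ?thesis
    proof (cases "av c = 1")
      case True
      then show ?thesis using bruhat k 1 by simp
    next
      case False
      have int: "av a \<le> 1" "av b \<le> 1" "av c \<le> 1" "av d \<le> 1" "av (a * d - b * c) = 1"
        using k by (auto simp: mat2_in_GL2_integers_iff)
      \<comment> \<open>The determinant is a unit, so \<open>a\<close> and \<open>c\<close> are not
        both in the maximal ideal; exchanging the rows brings a unit to the lower left.\<close>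
      have "av a = 1"
      proof (rule ccontr)
        assume "av a \<noteq> 1"
        then have "av (a * d - b * c) < 1"
          using int False av_mult_less[of c b] av_mult_less[of a d] av_diff_less[of "a * d" 1 "b * c"]
          by (simp add: mult.commute)
        then show False using int by simp
      qed
      moreover have "mat2 c d a b \<in> GL2_integers av"
        using int av_minus_commute[of "c * b" "d * a"] by (simp add: mat2_in_GL2_integers_iff mult.commute)
      ultimately have "\<rho> (mat2 0 1 1 0) (\<rho> (mat2 c d a b) ?s) = ?s" using bruhat swap by simp
      moreover have "d * a \<noteq> c * b" using int by (auto simp: mult.commute)
      ultimately show ?thesis using 1 by (simp add: rep_mat2_mult mult.commute)
    qed
  qed
  then show ?thesis by (simp add: fixed_vectors_def)
qed

end

section \<open>Linear forms on a representation of conductor one\<close>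

text \<open>\<open>\<phi>\<close> is invariant under the pointwise stabilizer of a path with
  \<open>n\<close> edges and vanishes on these edges. The matrix \<open>mat2 0 1 \<pi> 0\<close>
  reverses the edge carrying \<open>w\<close>, so \<open>\<epsilon>\<close> is the price of a change
  of orientation. For \<open>n = 0\<close> the invariance is under the whole maximal compact
  subgroup.\<close>

locale edge_functional = padic_rep av \<pi> R sc \<rho>
  for av :: "'f::field \<Rightarrow> real" and \<pi> R
    and sc :: "complex \<Rightarrow> 'v::ab_group_add \<Rightarrow> 'v" and \<rho> :: "'f mat2 \<Rightarrow> 'v \<Rightarrow> 'v" +
  fixes \<omega> :: "'f \<Rightarrow> complex" and w :: 'v and \<epsilon> :: complex and \<phi> :: "'v \<Rightarrow> complex" and n :: nat
  assumes central: "has_central_character sc \<rho> \<omega>"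
    and w_nonzero: "w \<noteq> 0"
    and w_fixed: "w \<in> fixed_vectors \<rho> (Gamma0 av \<pi>)"
    and w_eigen: "\<rho> (mat2 0 1 \<pi> 0) w = sc \<epsilon> w" and \<epsilon>_nonzero [simp]: "\<epsilon> \<noteq> 0"
    and no_spherical: "v \<in> fixed_vectors \<rho> (GL2_integers av) \<Longrightarrow> v = 0"
    and \<phi>_add: "\<phi> (x + y) = \<phi> x + \<phi> y" and \<phi>_scale: "\<phi> (sc c x) = c * \<phi> x"
    and \<phi>_invariant: "\<And>a b c d x. av a \<le> 1 \<Longrightarrow> av b \<le> 1 \<Longrightarrow> av c \<le> av \<pi> ^ n \<Longrightarrow> av d \<le> 1 \<Longrightarrow>
      av (a * d - b * c) = 1 \<Longrightarrow> \<phi> (\<rho> (mat2 a b c d) x) = \<phi> x"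
    and \<phi>_path: "i < n \<Longrightarrow> \<phi> (\<rho> (mat2 (\<pi> powi (- int i)) 0 0 1) w) = 0"
begin

text \<open>
  Edges of the Bruhat-Tits tree modulo orientation correspond to balls \<open>x + \<pi>\<^sup>m O\<close>; \<open>f m x\<close> is the
  value of \<open>\<phi>\<close> at the translate of \<open>w\<close> attached to such a ball. The balls \<open>\<pi>\<^sup>m O\<close> with
  \<open>-n < m \<le> 0\<close> form the path fixed by the group leaving \<open>\<phi>\<close> invariant.
\<close>

definition f :: "int \<Rightarrow> 'f \<Rightarrow> complex" where
  "f m x = \<phi> (\<rho> (mat2 (\<pi> powi m) x 0 1) w)"

lemma \<phi>_zero: "\<phi> 0 = 0"
  using \<phi>_scale[of 0 0] by simp

lemma \<phi>_sum: "\<phi> (sum g A) = (\<Sum>a\<in>A. \<phi> (g a))"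
  by (induction A rule: infinite_finite_induct) (auto simp: \<phi>_zero \<phi>_add)

lemma rep_scalar: "z \<noteq> 0 \<Longrightarrow> \<rho> (mat2 z 0 0 z) v = sc (\<omega> z) v"
  using central by (simp add: has_central_character_def mat_eq_mat2)

lemma \<omega>_pi: "\<omega> \<pi> = \<epsilon>\<^sup>2"
proof -
  have "\<rho> (mat2 0 1 \<pi> 0) (\<rho> (mat2 0 1 \<pi> 0) w) = sc (\<epsilon>\<^sup>2) w"
    by (simp add: w_eigen rep_scale mat2_in_GL2_iff power2_eq_square)
  moreover have "\<rho> (mat2 0 1 \<pi> 0) (\<rho> (mat2 0 1 \<pi> 0) w) = sc (\<omega> \<pi>) w"
    by (simp add: rep_mat2_mult rep_scalar)
  ultimately show ?thesis using w_nonzero by (metis scale_right_imp_eq)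
qed

lemma \<phi>_flip:
  assumes "a * d \<noteq> b * c"
  shows "\<phi> (\<rho> (mat2 (b * \<pi>) a (d * \<pi>) c) w) = \<epsilon> * \<phi> (\<rho> (mat2 a b c d) w)"
proof -
  have "\<rho> (mat2 (b * \<pi>) a (d * \<pi>) c) w = \<rho> (mat2 a b c d) (\<rho> (mat2 0 1 \<pi> 0) w)"
    using assms by (simp add: rep_mat2_mult)
  also have "\<dots> = sc \<epsilon> (\<rho> (mat2 a b c d) w)"
    using assms by (simp add: w_eigen rep_scale mat2_in_GL2_iff)
  finally show ?thesis by (simp add: \<phi>_scale)
qed

lemma upper_triangular:
  assumes "d \<noteq> 0" "a / d = \<pi> powi m * u" "av u = 1"
  shows "\<phi> (\<rho> (mat2 a b 0 d) w) = \<omega> d * f m (b / d)"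
proof -
  have u: "u \<noteq> 0" using assms by auto
  have a: "a = d * (\<pi> powi m * u)" using assms by (simp add: field_simps)
  have "\<rho> (mat2 u 0 0 1) w = w"
    using assms by (intro fixed_Gamma0[OF w_fixed]) auto
  moreover have "\<rho> (mat2 d 0 0 d) (\<rho> (mat2 (\<pi> powi m) (b / d) 0 1) (\<rho> (mat2 u 0 0 1) w))
      = \<rho> (mat2 a b 0 d) w"
    using assms(1) u by (simp add: rep_mat2_mult a)
  ultimately have "sc (\<omega> d) (\<rho> (mat2 (\<pi> powi m) (b / d) 0 1) w) = \<rho> (mat2 a b 0 d) w"
    using assms(1) rep_scalar by simp
  then show ?thesis unfolding f_def by (metis \<phi>_scale)
qed

lemma translate_right: "av u \<le> av \<pi> powi m \<Longrightarrow> f m (x + u) = f m x"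
proof -
  assume u: "av u \<le> av \<pi> powi m"
  have "\<rho> (mat2 1 (u / \<pi> powi m) 0 1) w = w"
    using u av_pi by (intro fixed_Gamma0[OF w_fixed]) (auto simp: divide_le_eq_1)
  moreover have "\<rho> (mat2 (\<pi> powi m) x 0 1) (\<rho> (mat2 1 (u / \<pi> powi m) 0 1) w)
      = \<rho> (mat2 (\<pi> powi m) (x + u) 0 1) w"
    by (simp add: rep_mat2_mult add.commute)
  ultimately show ?thesis by (simp add: f_def)
qed

lemma translate_left: "av u \<le> 1 \<Longrightarrow> f m (x + u) = f m x"
  using \<phi>_invariant[of 1 u 0 1 "\<rho> (mat2 (\<pi> powi m) x 0 1) w"] av_pi
  by (simp add: f_def rep_mat2_mult)

lemma unit_scaling:
  assumes u: "av u = 1"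
  shows "f m (u * x) = f m x"
proof -
  have u0: "u \<noteq> 0" using u by auto
  have "f m x = \<phi> (\<rho> (mat2 u 0 0 1) (\<rho> (mat2 (\<pi> powi m) x 0 1) w))"
    using u av_pi by (simp add: f_def \<phi>_invariant)
  also have "\<rho> (mat2 u 0 0 1) (\<rho> (mat2 (\<pi> powi m) x 0 1) w) = \<rho> (mat2 (\<pi> powi m * u) (u * x) 0 1) w"
    using u0 by (simp add: rep_mat2_mult mult.commute)
  also have "\<phi> \<dots> = \<omega> 1 * f m (u * x)"
    using upper_triangular[of 1 "\<pi> powi m * u" m u "u * x"] u by simp
  also have "\<omega> 1 = 1"
    using rep_scalar[of 1 w] w_nonzero scale_right_imp_eq[of w 1 "\<omega> 1"]
    by (simp add: rep_one flip: mat_eq_mat2)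
  finally show ?thesis by simp
qed

text \<open>The trace of \<open>w\<close> is spherical, hence zero, so the values on the edges at a
  vertex sum to zero. One edge is the ball itself; the others are its sub-balls, reversed, whence
  the factor \<open>1 / \<epsilon>\<close>.\<close>

lemma split: "f m x = - (\<Sum>u\<in>R. f (m + 1) (x + \<pi> powi m * u)) / \<epsilon>"
proof -
  let ?g = "mat2 (\<pi> powi m) x 0 1"
  have g: "?g \<in> carrier GL2" by (simp add: mat2_in_GL2_iff)
  have "w + (\<Sum>u\<in>R. \<rho> (mat2 u 1 1 0) w) = 0"
    by (rule no_spherical[OF trace_fixed[OF w_fixed]])
  then have "0 = \<phi> (\<rho> ?g (w + (\<Sum>u\<in>R. \<rho> (mat2 u 1 1 0) w)))"
    using g by (simp add: rep_zero \<phi>_zero)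
  also have "\<dots> = f m x + (\<Sum>u\<in>R. \<phi> (\<rho> ?g (\<rho> (mat2 u 1 1 0) w)))"
    using g by (simp add: rep_add rep_sum \<phi>_add \<phi>_sum f_def)
  also have "(\<Sum>u\<in>R. \<phi> (\<rho> ?g (\<rho> (mat2 u 1 1 0) w)))
      = (\<Sum>u\<in>R. f (m + 1) (x + \<pi> powi m * u) / \<epsilon>)"
  proof (intro sum.cong refl)
    fix u assume "u \<in> R"
    have "\<epsilon> * \<phi> (\<rho> ?g (\<rho> (mat2 u 1 1 0) w))
        = \<phi> (\<rho> (mat2 (\<pi> powi m * \<pi>) (\<pi> powi m * u + x) 0 1) w)"
      using \<phi>_flip[of "\<pi> powi m * u + x" 0 "\<pi> powi m" 1] by (simp add: rep_mat2_mult)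
    then show "\<phi> (\<rho> ?g (\<rho> (mat2 u 1 1 0) w)) = f (m + 1) (x + \<pi> powi m * u) / \<epsilon>"
      by (simp add: f_def power_int_add add.commute field_simps)
  qed
  finally show ?thesis by (simp add: sum_divide_distrib add_eq_0_iff2)
qed

lemma split_const:
  assumes "\<And>u. u \<in> R \<Longrightarrow> f (m + 1) (x + \<pi> powi m * u) = f (m + 1) y"
  shows "f m x = - of_nat (card R) * f (m + 1) y / \<epsilon>"
  using split[of m x] assms by simp

text \<open>The sub-balls of \<open>\<pi>^m O\<close> that miss \<open>0\<close> are permuted
  transitively by unit scalings, which preserve \<open>\<phi>\<close>, so only two values
  occur.\<close>

lemma split_origin:
  "f m 0 = - (f (m + 1) 0 + of_nat (card R - 1) * f (m + 1) (\<pi> powi m)) / \<epsilon>"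
proof -
  have "f (m + 1) (\<pi> powi m * u) = f (m + 1) (\<pi> powi m)" if "u \<in> R - {0}" for u
  proof -
    have "\<not> av (u - 0) < 1" using that R_separated[of u 0] zero_R by blast
    then have "av u = 1" using that R_integral[of u] by auto
    then show ?thesis using unit_scaling[of u "m + 1" "\<pi> powi m"] by (simp add: mult.commute)
  qed
  then have "(\<Sum>u\<in>R. f (m + 1) (0 + \<pi> powi m * u))
      = f (m + 1) 0 + of_nat (card R - 1) * f (m + 1) (\<pi> powi m)"
    using finite_R zero_R by (simp add: sum.remove[of _ 0])
  then show ?thesis using split[of m 0] by simp
qed

text \<open>
  The lower unipotent matrix with entry \<open>-\<pi>\<^sup>j\<close> moves the edge of \<open>\<pi>\<^sup>-\<^sup>j + \<pi>\<^sup>1\<^sup>-\<^sup>j O\<close> to that of \<open>\<pi>\<^sup>-\<^sup>j O\<close>.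
\<close>

lemma reflect:
  assumes "n \<le> j"
  shows "f (1 - int j) (\<pi> powi (- int j)) = \<epsilon> * f (- int j) 0"
proof -
  define p where "p = \<pi> powi (- int j)"
  have p: "p \<noteq> 0" "\<pi> ^ j * p = 1" by (simp_all add: p_def power_int_minus)
  have p1: "\<pi> powi (1 - int j) = p * \<pi>" by (simp add: p_def power_int_diff power_int_minus field_simps)
  have "f (1 - int j) p = \<phi> (\<rho> (mat2 1 0 (- (\<pi> ^ j)) 1) (\<rho> (mat2 (p * \<pi>) p 0 1) w))"
    unfolding f_def p1 using assms av_pi
    by (intro \<phi>_invariant[symmetric]) (auto simp: power_decreasing)
  also have "\<rho> (mat2 1 0 (- (\<pi> ^ j)) 1) (\<rho> (mat2 (p * \<pi>) p 0 1) w) = \<rho> (mat2 (p * \<pi>) p (- \<pi>) 0) w"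
    using p by (simp add: rep_mat2_mult algebra_simps)
  also have "\<epsilon> * \<phi> \<dots> = \<phi> (\<rho> (mat2 (p * \<pi>) (p * \<pi>) 0 (- \<pi>)) w)"
    using \<phi>_flip[of "p * \<pi>" 0 p "- \<pi>"] p by simp
  \<comment> \<open>The scalar \<open>\<pi>\<close> splits off with
    \<open>\<omega> \<pi> = \<epsilon>\<^sup>2\<close>; the flip takes back one factor
    \<open>\<epsilon>\<close>.\<close>
  also have "\<rho> (mat2 (p * \<pi>) (p * \<pi>) 0 (- \<pi>)) w = \<rho> (mat2 \<pi> 0 0 \<pi>) (\<rho> (mat2 p 0 0 1) (\<rho> (mat2 1 1 0 (- 1)) w))"
    using p by (simp add: rep_mat2_mult mult.commute)
  also have "\<rho> (mat2 1 1 0 (- 1)) w = w" by (rule fixed_Gamma0[OF w_fixed]) auto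
  finally have "\<epsilon> * f (1 - int j) p = \<epsilon>\<^sup>2 * f (- int j) 0"
    by (simp add: rep_scalar \<omega>_pi \<phi>_scale f_def p_def)
  then show ?thesis by (simp add: power2_eq_square p_def)
qed

text \<open>Past the far end, all sub-balls but one reflect to the ball itself, so
  \<open>split_origin\<close> relates two consecutive balls.\<close>

lemma beyond_path: "n \<le> j \<Longrightarrow> of_nat (card R) * f (- int j) 0 = - f (1 - int j) 0 / \<epsilon>"
proof -
  assume "n \<le> j"
  then have "f (- int j) 0 = - (f (1 - int j) 0 + of_nat (card R - 1) * (\<epsilon> * f (- int j) 0)) / \<epsilon>"
    using split_origin[of "- int j"] reflect[of j] by (simp add: add.commute)
  moreover have "of_nat (card R) = of_nat (card R - 1) + (1 :: complex)"
    using card_R by (simp flip: of_nat_Suc)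
  ultimately show ?thesis by (simp add: field_simps)
qed

text \<open>Past the near end, the sub-balls are integral translates of one another, and these
  translations preserve \<open>\<phi>\<close>.\<close>

lemma upward: "f m 0 = - of_nat (card R) * f (m + 1) 0 / \<epsilon>" if "0 \<le> m"
proof (rule split_const)
  fix u assume "u \<in> R"
  then have "av (\<pi> powi m * u) \<le> 1"
    using R_integral[of u] av_pi that by (simp add: power_int_def mult_le_one power_le_one av_nonneg)
  then show "f (m + 1) (0 + \<pi> powi m * u) = f (m + 1) 0" by (rule translate_left)
qed

lemma f_0_0: "f 0 0 = 0"
proof (cases "n = 0")
  case True
  let ?q = "of_nat (card R) :: complex"
  \<comment> \<open>With no edge given, both outward relations hold at the ball \<open>O\<close>;
    eliminating \<open>f 1 0\<close> leaves the factor \<open>?q * ?q - 1\<close>.\<close>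
  have "?q * f 0 0 = - f 1 0 / \<epsilon>" using beyond_path[of 0] True by simp
  moreover have "f 0 0 = - ?q * f 1 0 / \<epsilon>" using upward[of 0] by simp
  ultimately have "(?q * ?q - 1) * f 0 0 = 0" by (simp add: algebra_simps)
  moreover have "?q * ?q \<noteq> 1" using card_R by (simp flip: of_nat_mult)
  ultimately show ?thesis by simp
next
  case False
  then show ?thesis using \<phi>_path[of 0] by (simp add: f_def)
qed

lemma f_origin: "f m 0 = 0"
proof -
  have q: "of_nat (card R) \<noteq> (0 :: complex)" using card_R by simp
  have up: "f (int k) 0 = 0" for k
  proof (induction k)
    case (Suc k)
    then show ?case using upward[of "int k"] q by (simp add: add.commute)
  qed (simp add: f_0_0)
  have down: "f (- int k) 0 = 0" for k
  proof (induction k)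
    case (Suc k)
    show ?case
    proof (cases "Suc k < n")
      case True
      then show ?thesis using \<phi>_path[of "Suc k"] by (simp add: f_def)
    next
      case False
      then show ?thesis using beyond_path[of "Suc k"] Suc q by simp
    qed
  qed (simp add: f_0_0)
  show ?thesis using up down by (metis int_cases2)
qed

text \<open>The first index runs over all integers above \<open>j\<close>, where the ball misses
  \<open>0\<close> and has left the line of the balls \<open>\<pi>^m O\<close>. At the branch point
  the siblings are equal and sum to zero. Further out the sub-balls are exchanged by the units
  \<open>1 + \<pi> ^ Suc k * u\<close>.\<close>

lemma f_branch: "f (int k + 1 + j) (\<pi> powi j) = 0" if "j < 0"
proof (induction k)
  case 0
  have "of_nat (card R - 1) \<noteq> (0 :: complex)" using card_R by simp
  then show ?case using split_origin[of j] by (simp add: f_origin add.commute)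
next
  case (Suc k)
  let ?m = "int k + 1 + j"
  have "f ?m (\<pi> powi j) = - of_nat (card R) * f (?m + 1) (\<pi> powi j) / \<epsilon>"
  proof (rule split_const)
    fix u assume "u \<in> R"
    have "av (\<pi> ^ Suc k * u) < 1"
      using av_pi R_integral[OF \<open>u \<in> R\<close>]
      by (intro av_mult_less) (auto simp del: power_Suc intro: power_Suc_less_one)
    then have "av (1 + \<pi> ^ Suc k * u) = 1" by (subst av_add_eq) auto
    moreover have "\<pi> powi j + \<pi> powi ?m * u = (1 + \<pi> ^ Suc k * u) * \<pi> powi j"
    proof -
      have "\<pi> powi ?m = \<pi> powi (int (Suc k)) * \<pi> powi j"
        by (subst power_int_add[symmetric]) (auto simp: add.commute)
      then show ?thesis by (simp only: power_int_of_nat) (simp add: algebra_simps)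
    qed
    ultimately show "f (?m + 1) (\<pi> powi j + \<pi> powi ?m * u) = f (?m + 1) (\<pi> powi j)"
      by (simp add: unit_scaling)
  qed
  then show ?case using Suc card_R by (simp add: algebra_simps)
qed

text \<open>A unit scaling makes the centre a power of \<open>\<pi>\<close>. If the centre is
  integral or the ball contains \<open>0\<close>, the value is that at the centre \<open>0\<close>;
  otherwise the ball lies on a branch.\<close>

lemma f_eq_0: "f m x = 0"
proof (cases "x = 0")
  case False
  then obtain j u where u: "av u = 1" and x: "x = \<pi> powi j * u" by (rule obtain_valuation)
  have avx: "av x = av \<pi> powi j" using u x by simp
  show ?thesis
  proof (cases "j < 0 \<and> j < m")
    case True
    then have "f m (\<pi> powi j) = 0" using f_branch[of j "nat (m - 1 - j)"] by simp
    then show ?thesis using unit_scaling[OF u, of m "\<pi> powi j"] x by (simp add: mult.commute)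
  next
    case False
    then consider "0 \<le> j" | "m \<le> j" by linarith
    then have "f m (0 + x) = f m 0"
    proof cases
      case 1
      then show ?thesis using avx av_pi
        by (intro translate_left) (simp add: power_int_def power_le_one)
    next
      case 2
      then show ?thesis using avx av_pi by (intro translate_right) (simp add: power_int_decreasing)
    qed
    then show ?thesis by (simp add: f_origin)
  qed
qed (simp add: f_origin)

text \<open>If \<open>d\<close> dominates the lower row, a lower unipotent element of
  \<open>Gamma0\<close> clears \<open>c\<close>. Otherwise reversing the edge turns the lower row
  into \<open>d * \<pi>\<close> and \<open>c\<close>, and \<open>c\<close> dominates.\<close>

lemma \<phi>_translate_eq_0:
  assumes "g \<in> carrier GL2"
  shows "\<phi> (\<rho> g w) = 0"
proof -
  have main: "\<phi> (\<rho> (mat2 a b c d) w) = 0" if det: "a * d \<noteq> b * c" and cd: "av c < av d" for a b c d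
  proof -
    have d: "d \<noteq> 0" using cd av_nonneg[of c] by auto
    have "\<rho> (mat2 1 0 (- c / d) 1) w = w"
      using cd av_nonneg[of c] by (intro fixed_Gamma0[OF w_fixed]) (auto simp: divide_less_eq_1)
    moreover have "\<rho> (mat2 a b c d) (\<rho> (mat2 1 0 (- c / d) 1) w) = \<rho> (mat2 (a - b * c / d) b 0 d) w"
      using det d by (simp add: rep_mat2_mult)
    moreover have "(a - b * c / d) / d \<noteq> 0" using det d by (simp add: field_simps)
    then obtain m u where "av u = 1" "(a - b * c / d) / d = \<pi> powi m * u" by (rule obtain_valuation)
    ultimately show ?thesis using upper_triangular[OF d] f_eq_0 by simp
  qed
  obtain a b c d where g: "g = mat2 a b c d" "a * d \<noteq> b * c" using assms by (rule GL2_cases)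
  show ?thesis
  proof (cases "av c < av d")
    case False
    have "c \<noteq> 0" using g False av_nonneg[of c] av_nonneg[of d] av_pos[of d] by auto
    then have "av (d * \<pi>) < av c"
      using False av_pi av_pos[of c] mult_less_le_imp_less[of "av \<pi>" 1 "av d" "av c"]
      by (cases "d = 0") (auto simp: mult.commute av_nonneg av_pos)
    then have "\<phi> (\<rho> (mat2 (b * \<pi>) a (d * \<pi>) c) w) = 0" using g by (intro main) (auto simp: mult_ac)
    then show ?thesis using g \<phi>_flip by simp
  qed (use main g in simp)
qed

lemma \<phi>_eq_0: "irreducible_rep sc \<rho> \<Longrightarrow> \<phi> v = 0"
  by (rule irreducible_generates[where v = w])
    (use \<phi>_zero \<phi>_add \<phi>_scale w_nonzero \<phi>_translate_eq_0 in auto)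

end

section \<open>Spherical vectors\<close>

context padic_rep
begin

text \<open>By the Iwasawa decomposition a spherical function in the induced space is determined by
  its value at \<open>1\<close>. The combination \<open>?z\<close> is made to vanish there.\<close>

lemma spherical_unique:
  assumes ind: "isomorphic_to_induced av \<pi> sc \<rho> chi"
    and x: "x \<in> fixed_vectors \<rho> (GL2_integers av)" "x \<noteq> 0"
    and y: "y \<in> fixed_vectors \<rho> (GL2_integers av)"
  shows "\<exists>c. y = sc c x"
proof -
  obtain \<Phi> where lin: "Vector_Spaces.linear sc (\<lambda>c f x. c * f x) \<Phi>"
    and bij: "bij_betw \<Phi> UNIV (induced_space av \<pi> chi)"
    and equiv: "\<And>g v. g \<in> carrier GL2 \<Longrightarrow> \<Phi> (\<rho> g v) = (\<lambda>x. \<Phi> v (x ** g))"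
    using ind unfolding isomorphic_to_induced_def by blast
  have add: "\<Phi> (v + w) = \<Phi> v + \<Phi> w" and scale: "\<Phi> (sc c v) = (\<lambda>x. c * \<Phi> v x)" for v w c
    using lin by (simp_all add: Vector_Spaces.linear_iff)
  have determined: "z = 0"
    if z: "z \<in> fixed_vectors \<rho> (GL2_integers av)" and z1: "\<Phi> z (mat 1) = 0" for z
  proof -
    have ind_z: "\<Phi> z \<in> induced_space av \<pi> chi" using bij by (auto simp: bij_betw_def)
    have right: "\<Phi> z (g ** k) = \<Phi> z g" if "k \<in> GL2_integers av" for g k
    proof -
      have "\<Phi> (\<rho> k z) = (\<lambda>x. \<Phi> z (x ** k))" using that GL2_integers_subset by (intro equiv) auto
      moreover have "\<rho> k z = z" using z that by (simp add: fixed_vectors_def)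
      ultimately show ?thesis by metis
    qed
    have left: "\<Phi> z b = 0" if "b \<in> borel_subgroup" for b
    proof -
      have "\<Phi> z (b ** mat 1)
          = chi b * complex_of_real (sqrt (modulus_character av \<pi> b)) * \<Phi> z (mat 1)"
        using ind_z that GL2_one unfolding induced_space_def by blast
      then show ?thesis using z1 by simp
    qed
    have "\<Phi> z g = 0" for g
    proof (cases "g \<in> carrier GL2")
      case True
      then obtain a b c d where g: "g = mat2 a b c d" "a * d \<noteq> b * c" by (rule GL2_cases)
      obtain b' k where "g = b' ** k" "b' \<in> borel_subgroup" "k \<in> GL2_integers av"
      proof (cases "av c \<le> av d")
        case True
        have d: "d \<noteq> 0" using True g av_nonneg[of c] by auto
        have "g = mat2 (a - b * c / d) b 0 d ** mat2 1 0 (c / d) 1"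
          using d g by (simp add: mat2_mult)
        moreover have "mat2 (a - b * c / d) b 0 d \<in> borel_subgroup"
          using d g by (simp add: borel_subgroup_def mat2_in_GL2_iff field_simps)
        moreover have "mat2 1 0 (c / d) 1 \<in> GL2_integers av"
          using True av_pos[OF d] by (simp add: mat2_in_GL2_integers_iff divide_le_eq_1)
        ultimately show ?thesis by (rule that)
      next
        case False
        have c: "c \<noteq> 0" using False av_nonneg[of d] by auto
        have "g = mat2 (b - a * d / c) a 0 c ** mat2 0 1 1 (d / c)"
          using c g by (simp add: mat2_mult)
        moreover have "mat2 (b - a * d / c) a 0 c \<in> borel_subgroup"
          using c g by (simp add: borel_subgroup_def mat2_in_GL2_iff field_simps)
        moreover have "mat2 0 1 1 (d / c) \<in> GL2_integers av"
          using False av_pos[OF c] by (simp add: mat2_in_GL2_integers_iff divide_le_eq_1)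
        ultimately show ?thesis by (rule that)
      qed
      then show ?thesis using right left by simp
    next
      case False
      then show ?thesis using ind_z unfolding induced_space_def by blast
    qed
    moreover have "\<Phi> 0 = (\<lambda>x. 0)" using scale[of 0 0] by simp
    ultimately have "\<Phi> z = \<Phi> 0" by auto
    then show ?thesis using bij by (auto simp: bij_betw_def inj_def)
  qed
  let ?z = "sc (\<Phi> x (mat 1)) y + sc (- \<Phi> y (mat 1)) x"
  have "?z \<in> fixed_vectors \<rho> (GL2_integers av)"
    using x y GL2_integers_subset unfolding fixed_vectors_def
    by (auto simp: rep_add rep_scale subset_iff simp del: scale_minus_left)
  moreover have "\<Phi> ?z (mat 1) = 0" by (simp add: add scale del: scale_minus_left)
  ultimately have "?z = 0" by (rule determined)
  then have eq: "sc (\<Phi> x (mat 1)) y = sc (\<Phi> y (mat 1)) x"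
    by (simp add: add_eq_0_iff2)
  have nz: "\<Phi> x (mat 1) \<noteq> 0" using determined x by blast
  then have "y = sc (inverse (\<Phi> x (mat 1))) (sc (\<Phi> x (mat 1)) y)" by simp
  also have "\<dots> = sc (inverse (\<Phi> x (mat 1)) * \<Phi> y (mat 1)) x" unfolding eq by simp
  finally show ?thesis ..
qed

text \<open>The Hecke sum is the trace of a \<open>Gamma0\<close>-fixed vector, hence spherical,
  hence a multiple of \<open>v\<close>. The second equation, obtained with the swap, lists the same
  neighbouring vertices by lower triangular representatives, as the other end of a path
  requires.\<close>

lemma hecke_eigenvector:
  assumes ind: "isomorphic_to_induced av \<pi> sc \<rho> chi"
    and v: "v \<in> fixed_vectors \<rho> (GL2_integers av)" "v \<noteq> 0"
  shows "\<exists>c. \<rho> (mat2 1 0 0 \<pi>) v + (\<Sum>u\<in>R. \<rho> (mat2 \<pi> u 0 1) v) = sc c v \<and>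
    \<rho> (mat2 \<pi> 0 0 1) v + (\<Sum>u\<in>R. \<rho> (mat2 1 0 u \<pi>) v) = sc c v"
proof -
  let ?t = "\<rho> (mat2 1 0 0 \<pi>) v" and ?J = "mat2 0 1 1 0"
  have J: "\<rho> ?J v = v" by (rule fixed_GL2_integers[OF v(1)]) auto
  have "?t \<in> fixed_vectors \<rho> (Gamma0 av \<pi>)"
    unfolding fixed_vectors_def
  proof safe
    fix k assume k: "k \<in> Gamma0 av \<pi>"
    obtain a b c d where k_eq: "k = mat2 a b c d" by (rule mat2_cases)
    have int: "av a \<le> 1" "av b \<le> 1" "av c \<le> av \<pi>" "av d \<le> 1" "av (a * d - b * c) = 1"
      using k unfolding k_eq mat2_in_Gamma0_iff av_less_one_iff[of c] by auto
    then have det: "a * d \<noteq> b * c" by auto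
    have "\<rho> (mat2 a (\<pi> * b) (c / \<pi>) d) v = v"
      using int av_pi av_mult_le[of \<pi> 1 b]
      by (intro fixed_GL2_integers[OF v(1)]) (auto simp: divide_le_eq_1 mult.commute)
    then have "?t = \<rho> (mat2 1 0 0 \<pi>) (\<rho> (mat2 a (\<pi> * b) (c / \<pi>) d) v)" by simp
    also have "\<dots> = \<rho> k ?t" using det by (simp add: rep_mat2_mult k_eq mult.commute)
    finally show "\<rho> k ?t = ?t" ..
  qed
  then have "?t + (\<Sum>u\<in>R. \<rho> (mat2 u 1 1 0) ?t) \<in> fixed_vectors \<rho> (GL2_integers av)"
    by (rule trace_fixed)
  moreover have "\<rho> (mat2 u 1 1 0) ?t = \<rho> (mat2 \<pi> u 0 1) v" for u
  proof -
    have "\<rho> (mat2 \<pi> u 0 1) (\<rho> ?J v) = \<rho> (mat2 u 1 1 0) ?t" by (simp add: rep_mat2_mult)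
    then show ?thesis by (simp add: J)
  qed
  ultimately have "?t + (\<Sum>u\<in>R. \<rho> (mat2 \<pi> u 0 1) v) \<in> fixed_vectors \<rho> (GL2_integers av)"
    by simp
  then obtain c where c: "?t + (\<Sum>u\<in>R. \<rho> (mat2 \<pi> u 0 1) v) = sc c v"
    using spherical_unique[OF ind v] by blast
  have conj: "\<rho> ?J (\<rho> (mat2 a b 0 d) v) = \<rho> (mat2 d 0 b a) v" if "a \<noteq> 0" "d \<noteq> 0" for a b d
  proof -
    have "\<rho> ?J (\<rho> (mat2 a b 0 d) (\<rho> ?J v)) = \<rho> (mat2 d 0 b a) v"
      using that by (simp add: rep_mat2_mult)
    then show ?thesis by (simp add: J)
  qed
  have "\<rho> ?J (?t + (\<Sum>u\<in>R. \<rho> (mat2 \<pi> u 0 1) v)) = sc c v"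
    unfolding c by (simp add: rep_scale J mat2_in_GL2_iff)
  then have "\<rho> (mat2 \<pi> 0 0 1) v + (\<Sum>u\<in>R. \<rho> (mat2 1 0 u \<pi>) v) = sc c v"
    by (simp add: rep_add rep_sum conj mat2_in_GL2_iff)
  with c show ?thesis by blast
qed

end

section \<open>The trilinear form\<close>

locale spherical_pair_form =
  V1: padic_rep av \<pi> R sc1 \<rho>1 + V2: padic_rep av \<pi> R sc2 \<rho>2 + V3: padic_rep av \<pi> R sc3 \<rho>3
  for av :: "'f::field \<Rightarrow> real" and \<pi> R
    and sc1 :: "complex \<Rightarrow> 'v1::ab_group_add \<Rightarrow> 'v1" and \<rho>1 :: "'f mat2 \<Rightarrow> 'v1 \<Rightarrow> 'v1"
    and sc2 :: "complex \<Rightarrow> 'v2::ab_group_add \<Rightarrow> 'v2" and \<rho>2 :: "'f mat2 \<Rightarrow> 'v2 \<Rightarrow> 'v2"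
    and sc3 :: "complex \<Rightarrow> 'v3::ab_group_add \<Rightarrow> 'v3" and \<rho>3 :: "'f mat2 \<Rightarrow> 'v3 \<Rightarrow> 'v3" +
  fixes \<omega>1 \<omega>2 \<omega>3 :: "'f \<Rightarrow> complex" and \<l> :: "'v1 \<Rightarrow> 'v2 \<Rightarrow> 'v3 \<Rightarrow> complex"
    and v1 v2 and t1 t2 :: complex
  assumes irreducible: "irreducible_rep sc1 \<rho>1" "irreducible_rep sc2 \<rho>2" "irreducible_rep sc3 \<rho>3"
    and central: "has_central_character sc1 \<rho>1 \<omega>1" "has_central_character sc2 \<rho>2 \<omega>2"
      "has_central_character sc3 \<rho>3 \<omega>3"
    and trilinear: "trilinear_form sc1 sc2 sc3 \<l>"
    and invariant: "g \<in> carrier GL2 \<Longrightarrow> \<l> (\<rho>1 g x) (\<rho>2 g y) (\<rho>3 g z) = \<l> x y z"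
    and v1: "v1 \<in> fixed_vectors \<rho>1 (GL2_integers av)" "v1 \<noteq> 0"
    and v2: "v2 \<in> fixed_vectors \<rho>2 (GL2_integers av)" "v2 \<noteq> 0"
    and no_spherical: "z \<in> fixed_vectors \<rho>3 (GL2_integers av) \<Longrightarrow> z = 0"
    and hecke1: "\<rho>1 (mat2 1 0 0 \<pi>) v1 + (\<Sum>u\<in>R. \<rho>1 (mat2 \<pi> u 0 1) v1) = sc1 t1 v1"
    and hecke2: "\<rho>2 (mat2 \<pi> 0 0 1) v2 + (\<Sum>u\<in>R. \<rho>2 (mat2 1 0 u \<pi>) v2) = sc2 t2 v2"
begin

lemma form_linear:
  "\<l> (x + x') y z = \<l> x y z + \<l> x' y z" "\<l> (sc1 c x) y z = c * \<l> x y z"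
  "\<l> x (y + y') z = \<l> x y z + \<l> x y' z" "\<l> x (sc2 c y) z = c * \<l> x y z"
  "\<l> x y (z + z') = \<l> x y z + \<l> x y z'" "\<l> x y (sc3 c z) = c * \<l> x y z"
  using trilinear by (simp_all add: trilinear_form_def Vector_Spaces.linear_iff)

lemma form_zero: "\<l> 0 y z = 0" "\<l> x 0 z = 0" "\<l> x y 0 = 0"
  using form_linear(1)[of 0 0] form_linear(3)[of _ 0 0] form_linear(5)[of _ _ 0 0] by simp_all

lemma form_sum1: "\<l> (sum h A) y z = (\<Sum>a\<in>A. \<l> (h a) y z)"
  by (induction A rule: infinite_finite_induct) (auto simp: form_zero form_linear)

lemma form_sum2: "\<l> x (sum h A) z = (\<Sum>a\<in>A. \<l> x (h a) z)"
  by (induction A rule: infinite_finite_induct) (auto simp: form_zero form_linear)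

lemma scalars:
  assumes "z \<noteq> 0"
  shows "\<rho>1 (mat2 z 0 0 z) x = sc1 (\<omega>1 z) x" "\<rho>2 (mat2 z 0 0 z) y = sc2 (\<omega>2 z) y"
    "\<rho>3 (mat2 z 0 0 z) t = sc3 (\<omega>3 z) t"
  using central assms by (simp_all add: has_central_character_def mat_eq_mat2)

text \<open>The spherical vectors sit at two vertices at distance \<open>n\<close>;
  \<open>n = 1\<close> is the case of \<open>v2\<^sup>*\<close>.\<close>

definition \<phi> :: "nat \<Rightarrow> 'v3 \<Rightarrow> complex" where
  "\<phi> n z = \<l> v1 (\<rho>2 (mat2 (\<pi> powi (- int n)) 0 0 1) v2) z"

lemma \<phi>_linear: "\<phi> n (x + y) = \<phi> n x + \<phi> n y" "\<phi> n (sc3 c x) = c * \<phi> n x"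
  by (simp_all add: \<phi>_def form_linear)

text \<open>Such matrices lie in both vertex stabilizers: undoing \<open>?D\<close> turns
  \<open>b\<close> and \<open>c\<close> into \<open>\<pi> ^ n * b\<close> and
  \<open>c / \<pi> ^ n\<close>, still integral.\<close>

lemma \<phi>_invariant:
  assumes "av a \<le> 1" "av b \<le> 1" "av c \<le> av \<pi> ^ n" "av d \<le> 1" "av (a * d - b * c) = 1"
  shows "\<phi> n (\<rho>3 (mat2 a b c d) z) = \<phi> n z"
proof -
  let ?k = "mat2 a b c d" and ?D = "mat2 (\<pi> powi (- int n)) 0 0 1"
  have det: "a * d \<noteq> b * c" using assms by auto
  have pn: "av \<pi> ^ n \<le> 1" using V1.av_pi by (simp add: power_le_one)
  then have 1: "\<rho>1 ?k v1 = v1" using assms by (intro V1.fixed_GL2_integers[OF v1(1)]) auto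
  have "\<rho>2 (mat2 a (\<pi> ^ n * b) (c / \<pi> ^ n) d) v2 = v2"
    using assms pn V1.av_pi V1.av_mult_le[of "\<pi> ^ n" 1 b]
    by (intro V2.fixed_GL2_integers[OF v2(1)]) (auto simp: divide_le_eq_1 mult.commute)
  moreover have "\<rho>2 ?D (\<rho>2 (mat2 a (\<pi> ^ n * b) (c / \<pi> ^ n) d) v2) = \<rho>2 ?k (\<rho>2 ?D v2)"
    using det by (simp add: V2.rep_mat2_mult power_int_minus field_simps)
  ultimately have 2: "\<rho>2 ?k (\<rho>2 ?D v2) = \<rho>2 ?D v2" by simp
  show ?thesis
    using invariant[of ?k v1 "\<rho>2 ?D v2" z] det by (simp add: \<phi>_def 1 2 mat2_in_GL2_iff)
qed

lemma edge_functional_\<phi>: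
  assumes "w \<noteq> 0" "w \<in> fixed_vectors \<rho>3 (Gamma0 av \<pi>)"
    "\<rho>3 (mat2 0 1 \<pi> 0) w = sc3 \<epsilon> w" "\<epsilon> \<noteq> 0"
    "\<And>i. i < n \<Longrightarrow> \<phi> n (\<rho>3 (mat2 (\<pi> powi (- int i)) 0 0 1) w) = 0"
  shows "\<phi> n z = 0"
proof -
  interpret edge_functional av \<pi> R sc3 \<rho>3 \<omega>3 w \<epsilon> "\<phi> n" n
    by unfold_locales (use assms central no_spherical \<phi>_linear \<phi>_invariant in auto)
  show ?thesis by (rule \<phi>_eq_0[OF irreducible(3)])
qed

text \<open>\<open>?W\<close> normalizes \<open>Gamma0\<close> and its square is the scalar
  \<open>\<mu> * \<mu>\<close>, so \<open>w \<mu>\<close> and \<open>w (- \<mu>)\<close> lie in its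
  eigenspaces. They are not both zero, and \<open>\<phi> 1\<close> takes the same value on both
  because it kills \<open>v3\<close>.\<close>

lemma obtain_eigenvector:
  assumes v3: "v3 \<in> fixed_vectors \<rho>3 (Gamma0 av \<pi>)" "v3 \<noteq> 0" and zero: "\<phi> 1 v3 = 0"
  obtains w \<epsilon> where "w \<noteq> 0" "w \<in> fixed_vectors \<rho>3 (Gamma0 av \<pi>)"
    "\<rho>3 (mat2 0 1 \<pi> 0) w = sc3 \<epsilon> w" "\<epsilon> \<noteq> 0" "\<phi> 1 w = 0"
proof -
  let ?W = "mat2 0 1 \<pi> 0"
  have W: "?W \<in> carrier GL2" by (simp add: mat2_in_GL2_iff)
  define v' where "v' = \<rho>3 ?W v3"
  define \<mu> where "\<mu> = csqrt (\<omega>3 \<pi>)"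
  have WW: "\<rho>3 ?W (\<rho>3 ?W z) = sc3 (\<mu> * \<mu>) z" for z
    using scalars(3)[of \<pi> z] by (simp add: V3.rep_mat2_mult \<mu>_def flip: power2_eq_square)
  have \<mu>: "\<mu> \<noteq> 0"
  proof
    assume "\<mu> = 0"
    then have "\<rho>3 ?W (\<rho>3 ?W v3) = 0" by (simp add: WW)
    then show False using W v3 by (simp add: V3.rep_eq_0_iff)
  qed
  have fixed': "\<rho>3 (mat2 a b c d) v' = v'" if k: "mat2 a b c d \<in> Gamma0 av \<pi>" for a b c d
  proof -
    have int: "av a \<le> 1" "av b \<le> 1" "av c \<le> av \<pi>" "av d \<le> 1" "av (a * d - b * c) = 1"
      using k unfolding V1.mat2_in_Gamma0_iff V1.av_less_one_iff[of c] by auto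
    then have det: "a * d \<noteq> b * c" by auto
    have "\<rho>3 (mat2 d (c / \<pi>) (\<pi> * b) a) v3 = v3"
      using int V1.av_pi V1.av_mult_less[of \<pi> b]
      by (intro V3.fixed_Gamma0[OF v3(1)]) (auto simp: divide_le_eq_1 mult.commute)
    then have "v' = \<rho>3 ?W (\<rho>3 (mat2 d (c / \<pi>) (\<pi> * b) a) v3)" by (simp add: v'_def)
    also have "\<dots> = \<rho>3 (mat2 a b c d) v'"
      using det by (simp add: v'_def V3.rep_mat2_mult mult.commute)
    finally show ?thesis ..
  qed
  define w where "w s = v' + sc3 s v3" for s
  have w_fixed: "w s \<in> fixed_vectors \<rho>3 (Gamma0 av \<pi>)" for s
    unfolding fixed_vectors_def
  proof safe
    fix k assume k: "k \<in> Gamma0 av \<pi>"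
    obtain a b c d where k_eq: "k = mat2 a b c d" by (rule mat2_cases)
    have "k \<in> carrier GL2" using k V1.GL2_integers_subset by (auto simp: Gamma0_def)
    moreover have "\<rho>3 k v3 = v3" using v3 k by (simp add: fixed_vectors_def)
    ultimately show "\<rho>3 k (w s) = w s"
      using fixed' k by (simp add: w_def k_eq V3.rep_add V3.rep_scale)
  qed
  have W_w: "\<rho>3 ?W (w s) = sc3 s (w s)" if "s * s = \<mu> * \<mu>" for s
    using WW[of v3] that W
    by (simp add: w_def V3.rep_add V3.rep_scale v'_def V3.scale_right_distrib add.commute)
  have \<phi>w: "\<phi> 1 (w s) = \<phi> 1 v'" for s using zero by (simp add: w_def \<phi>_linear)
  have "w \<mu> \<noteq> 0 \<or> w (- \<mu>) \<noteq> 0"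
  proof (rule ccontr)
    assume "\<not> (w \<mu> \<noteq> 0 \<or> w (- \<mu>) \<noteq> 0)"
    then have "sc3 \<mu> v3 = sc3 (- \<mu>) v3" unfolding w_def by (metis add_left_cancel)
    then have "\<mu> = - \<mu>" using v3(2) V3.scale_right_imp_eq by blast
    then show False using \<mu> by simp
  qed
  then obtain s where s: "s = \<mu> \<or> s = - \<mu>" "w s \<noteq> 0" by blast
  \<comment> \<open>Otherwise \<open>\<psi>\<close>, built to be \<open>Gamma0\<close>-invariant and
    zero on \<open>w (- \<mu>)\<close>, is zero by the criterion for a single edge. Yet its value at
    \<open>w \<mu>\<close> is \<open>2 * \<mu> * \<phi> 1 v'\<close>.\<close>
  have "\<phi> 1 v' = 0"
  proof (rule ccontr)
    assume v': "\<phi> 1 v' \<noteq> 0"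
    define \<psi> where "\<psi> z = \<mu> * \<phi> 1 z + \<phi> 1 (\<rho>3 ?W z)" for z
    have "w (- \<mu>) \<noteq> 0"
    proof
      assume "w (- \<mu>) = 0"
      then show False using v' \<phi>w[of "- \<mu>"] \<phi>_linear(2)[of 1 0 0] by simp
    qed
    have inv: "\<psi> (\<rho>3 (mat2 a b c d) z) = \<psi> z"
      if int: "av a \<le> 1" "av b \<le> 1" "av c \<le> av \<pi> ^ 1" "av d \<le> 1" "av (a * d - b * c) = 1"
      for a b c d z
    proof -
      have det: "a * d \<noteq> b * c" using int by auto
      have "\<phi> 1 (\<rho>3 (mat2 d (c / \<pi>) (\<pi> * b) a) (\<rho>3 ?W z)) = \<phi> 1 (\<rho>3 ?W z)"
        using int V1.av_pi V1.av_mult_le[of \<pi> "av \<pi>" b]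
        by (intro \<phi>_invariant) (auto simp: divide_le_eq_1 mult.commute)
      moreover have "\<rho>3 (mat2 d (c / \<pi>) (\<pi> * b) a) (\<rho>3 ?W z) = \<rho>3 ?W (\<rho>3 (mat2 a b c d) z)"
        using det by (simp add: V3.rep_mat2_mult mult.commute)
      moreover have "\<phi> 1 (\<rho>3 (mat2 a b c d) z) = \<phi> 1 z" using int by (intro \<phi>_invariant)
      ultimately show ?thesis by (simp add: \<psi>_def)
    qed
    interpret edge_functional av \<pi> R sc3 \<rho>3 \<omega>3 "w (- \<mu>)" "- \<mu>" \<psi> 1
    proof unfold_locales
      show "\<psi> (\<rho>3 (mat2 (\<pi> powi (- int i)) 0 0 1) (w (- \<mu>))) = 0" if "i < 1" for i
        using that by (simp add: V3.rep_one \<psi>_def W_w \<phi>_linear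
            del: V3.scale_minus_left flip: mat_eq_mat2)
    qed (use \<open>w (- \<mu>) \<noteq> 0\<close> \<mu> w_fixed W_w central no_spherical inv W
        in \<open>auto simp: \<psi>_def \<phi>_linear V3.rep_add V3.rep_scale algebra_simps\<close>)
    have "\<psi> (w \<mu>) = 2 * \<mu> * \<phi> 1 v'" by (simp add: \<psi>_def W_w \<phi>_linear \<phi>w del: One_nat_def)
    then show False using \<phi>_eq_0[OF irreducible(3), of "w \<mu>"] v' \<mu> by simp
  qed
  then show ?thesis using that[of "w s" s] s w_fixed W_w \<mu> \<phi>w by auto
qed

text \<open>
  Induction on the distance \<open>n\<close> between the vertices carrying the two spherical vectors. In the
  Hecke relation at one end of the path the shorter distances contribute zero, and the remaining
  terms agree by invariance under a unipotent group fixing the rest of the path.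
\<close>

lemma \<phi>_eq_0:
  assumes w: "w \<noteq> 0" "w \<in> fixed_vectors \<rho>3 (Gamma0 av \<pi>)"
    "\<rho>3 (mat2 0 1 \<pi> 0) w = sc3 \<epsilon> w" "\<epsilon> \<noteq> 0" "\<phi> 1 w = 0"
  shows "\<phi> n z = 0"
proof (induction n arbitrary: z rule: less_induct)
  case (less n)
  let ?D = "\<lambda>m. mat2 (\<pi> powi m) 0 0 1"
  have D: "?D m \<in> carrier GL2" for m by (simp add: mat2_in_GL2_iff)
  have DD2: "\<rho>2 (?D k) (\<rho>2 (?D m) y) = \<rho>2 (?D (k + m)) y" for k m y
    by (simp add: V2.rep_mat2_mult power_int_add)
  have card0: "of_nat (card R) \<noteq> (0 :: complex)" using V1.card_R by simp
  have path: "\<phi> n (\<rho>3 (?D (- int i)) w) = 0" if "i < n" for i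
  proof -
    \<comment> \<open>For \<open>n = 1\<close> the hypothesis on \<open>w\<close> applies. Otherwise
      the end to be moved is one that edge \<open>i\<close> does not touch: that of
      \<open>v1\<close> if \<open>i \<ge> 1\<close>, that of \<open>v2\<close> if
      \<open>i = 0\<close>.\<close>
    consider "n = 1" | "n \<ge> 2" "i \<ge> 1" | "n \<ge> 2" "i = 0" using \<open>i < n\<close> by linarith
    then show ?thesis
    proof cases
      case 1
      then show ?thesis using that w by (simp add: V3.rep_one flip: mat_eq_mat2)
    next
      case 2
      let ?y = "\<rho>2 (?D (- int n)) v2" and ?z = "\<rho>3 (?D (- int i)) w"
      \<comment> \<open>Translation by \<open>?D (int k)\<close> returns the first vertex to the
        origin and shows a distance \<open>n - k\<close>, to which the induction hypothesis
        applies.\<close>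
      have shift: "\<l> (\<rho>1 (?D (- int k)) v1) ?y ?z = 0" if k: "k \<ge> 1" "k \<le> n" for k
      proof -
        have "\<rho>1 (?D (int k)) (\<rho>1 (?D (- int k)) v1) = v1"
          by (simp add: V1.rep_mat2_mult V1.rep_one power_int_minus flip: mat_eq_mat2)
        then have "\<l> (\<rho>1 (?D (- int k)) v1) ?y ?z = \<l> v1 (\<rho>2 (?D (int k)) ?y) (\<rho>3 (?D (int k)) ?z)"
          using invariant[OF D[of "int k"], of "\<rho>1 (?D (- int k)) v1" ?y ?z] by simp
        also have "\<dots> = \<phi> (n - k) (\<rho>3 (?D (int k)) ?z)"
          unfolding DD2 using k by (simp add: \<phi>_def of_nat_diff)
        finally show ?thesis using less k by simp
      qed
      \<comment> \<open>The Hecke relation at the next vertex of the path: it is at distance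
        \<open>n - 1\<close> from the far end, one of its neighbours at distance
        \<open>n - 2\<close>, the others at distance \<open>n\<close>.\<close>
      have "\<l> (\<rho>1 (?D (-1)) (\<rho>1 (mat2 1 0 0 \<pi>) v1 + (\<Sum>u\<in>R. \<rho>1 (mat2 \<pi> u 0 1) v1))) ?y ?z = 0"
        using shift[of 1] 2 unfolding hecke1 V1.rep_scale[OF D] form_linear by simp
      moreover have "\<rho>1 (?D (-1)) (\<rho>1 (mat2 1 0 0 \<pi>) v1)
          = \<rho>1 (mat2 \<pi> 0 0 \<pi>) (\<rho>1 (?D (- int 2)) v1)"
        by (simp add: V1.rep_mat2_mult power_int_minus power2_eq_square flip: mult.assoc)
      then have "\<l> (\<rho>1 (?D (-1)) (\<rho>1 (mat2 1 0 0 \<pi>) v1)) ?y ?z = 0"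
        using shift[of 2] 2 scalars(1)[of \<pi>] form_linear by simp
      moreover have "\<l> (\<rho>1 (?D (-1)) (\<rho>1 (mat2 \<pi> u 0 1) v1)) ?y ?z = \<phi> n ?z" if "u \<in> R" for u
      proof -
        let ?n = "mat2 1 (u / \<pi>) 0 1"
        have avu: "av (\<pi> ^ k * (u / \<pi>)) \<le> 1" if "1 \<le> k" for k
        proof -
          have "\<pi> ^ k * (u / \<pi>) = \<pi> ^ (k - 1) * u" using that by (cases k) auto
          moreover have "av (\<pi> ^ (k - 1)) \<le> 1" using V1.av_pi by (simp add: power_le_one)
          ultimately show ?thesis
            using V1.av_mult_le[of "\<pi> ^ (k - 1)" 1 u] V1.R_integral[OF \<open>u \<in> R\<close>] by simp
        qed
        have "\<rho>2 (mat2 1 (\<pi> ^ n * (u / \<pi>)) 0 1) v2 = v2"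
          using avu[of n] 2 by (intro V2.fixed_GL2_integers[OF v2(1)]) auto
        moreover have "\<rho>2 ?n ?y = \<rho>2 (?D (- int n)) (\<rho>2 (mat2 1 (\<pi> ^ n * (u / \<pi>)) 0 1) v2)"
          by (simp add: V2.rep_mat2_mult power_int_minus flip: mult.assoc)
        ultimately have y: "\<rho>2 ?n ?y = ?y" by simp
        have "\<rho>3 (mat2 1 (\<pi> ^ i * (u / \<pi>)) 0 1) w = w"
          using avu[of i] 2 by (intro V3.fixed_Gamma0[OF w(2)]) auto
        moreover have "\<rho>3 ?n ?z = \<rho>3 (?D (- int i)) (\<rho>3 (mat2 1 (\<pi> ^ i * (u / \<pi>)) 0 1) w)"
          by (simp add: V3.rep_mat2_mult power_int_minus flip: mult.assoc)
        ultimately have z: "\<rho>3 ?n ?z = ?z" by simp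
        have "\<rho>1 (?D (-1)) (\<rho>1 (mat2 \<pi> u 0 1) v1) = \<rho>1 ?n v1"
          by (simp add: V1.rep_mat2_mult power_int_minus field_simps)
        then show ?thesis
          using invariant[of ?n v1 ?y ?z] by (simp add: y z \<phi>_def mat2_in_GL2_iff)
      qed
      ultimately have "of_nat (card R) * \<phi> n ?z = 0"
        unfolding V1.rep_add[OF D] V1.rep_sum[OF D] form_linear form_sum1 by simp
      then show ?thesis using card0 by simp
    next
      case 3
      have prev: "\<l> v1 (\<rho>2 (?D (int k - int n)) v2) w = 0" if "k \<ge> 1" "k \<le> n" for k
        using less[of "n - k" w] that by (simp add: \<phi>_def of_nat_diff)
      \<comment> \<open>The same at the other end. The representatives are lower triangular so that
        the unipotent parts fix \<open>v1\<close> and \<open>w\<close>.\<close>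
      have "\<l> v1 (\<rho>2 (?D (1 - int n)) (\<rho>2 (mat2 \<pi> 0 0 1) v2 + (\<Sum>u\<in>R. \<rho>2 (mat2 1 0 u \<pi>) v2))) w = 0"
        using prev[of 1] 3 unfolding hecke2 V2.rep_scale[OF D] form_linear by simp
      moreover have "\<rho>2 (?D (1 - int n)) (\<rho>2 (mat2 \<pi> 0 0 1) v2) = \<rho>2 (?D (2 - int n)) v2"
        using DD2[of "1 - int n" 1 v2] by simp
      then have "\<l> v1 (\<rho>2 (?D (1 - int n)) (\<rho>2 (mat2 \<pi> 0 0 1) v2)) w = 0"
        using prev[of 2] 3 by simp
      moreover have "\<l> v1 (\<rho>2 (?D (1 - int n)) (\<rho>2 (mat2 1 0 u \<pi>) v2)) w = \<omega>2 \<pi> * \<phi> n w"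
        if "u \<in> R" for u
      proof -
        \<comment> \<open>The entry that appears when \<open>?D (1 - int n)\<close> is moved to the
          right past the unipotent part. It lies in the maximal ideal because
          \<open>n \<ge> 2\<close>.\<close>
        define c where "c = \<pi> ^ (n - 1) * u"
        have "av (\<pi> ^ (n - 1)) < 1" using V1.av_pi 3 by (simp add: power_less_one_iff)
        then have c: "av c < 1" unfolding c_def using V1.R_integral[OF that] by (rule V1.av_mult_less)
        have "\<rho>1 (mat2 1 0 c 1) v1 = v1"
          using c by (intro V1.fixed_GL2_integers[OF v1(1)]) auto
        moreover have "\<rho>3 (mat2 1 0 c 1) w = w"
          using c by (intro V3.fixed_Gamma0[OF w(2)]) auto
        ultimately have "\<l> v1 (\<rho>2 (mat2 1 0 c 1) y) w = \<l> v1 y w" for y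
          using invariant[of "mat2 1 0 c 1" v1 y w] by (simp add: mat2_in_GL2_iff)
        moreover have "\<rho>2 (?D (1 - int n)) (\<rho>2 (mat2 1 0 u \<pi>) v2)
            = \<rho>2 (mat2 1 0 c 1) (\<rho>2 (mat2 \<pi> 0 0 \<pi>) (\<rho>2 (?D (- int n)) v2))"
        proof -
          have "\<pi> powi (1 - int n) = \<pi> * \<pi> powi (- int n)"
            by (simp add: power_int_diff power_int_minus field_simps)
          moreover have "c * (\<pi> * \<pi> powi (- int n)) = u"
          proof -
            have "\<pi> ^ (n - 1) * \<pi> = \<pi> ^ n" using 3 by (cases n) auto
            then have "c * (\<pi> * \<pi> powi (- int n)) = u * (\<pi> ^ n * \<pi> powi (- int n))"
              by (simp add: c_def mult_ac)
            then show ?thesis by (simp add: power_int_minus)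
          qed
          ultimately show ?thesis by (simp add: V2.rep_mat2_mult)
        qed
        ultimately show ?thesis using scalars(2)[of \<pi>] by (simp add: \<phi>_def form_linear)
      qed
      ultimately have "of_nat (card R) * (\<omega>2 \<pi> * \<phi> n w) = 0"
        unfolding V2.rep_add[OF D] V2.rep_sum[OF D] form_linear form_sum2 by simp
      moreover have "\<omega>2 \<pi> \<noteq> 0"
      proof
        assume "\<omega>2 \<pi> = 0"
        then have "\<rho>2 (mat2 \<pi> 0 0 \<pi>) v2 = 0" using scalars(2)[of \<pi> v2] by simp
        then show False using v2(2) by (simp add: V2.rep_eq_0_iff mat2_in_GL2_iff)
      qed
      ultimately show ?thesis
        using card0 3 by (simp add: V3.rep_one flip: mat_eq_mat2)
    qed
  qed
  show ?case by (rule edge_functional_\<phi>[OF w(1-4) path])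
qed

text \<open>By the Cartan decomposition every translate of \<open>v2\<close> is, up to a scalar and
  an integral matrix on the left, one of those in \<open>\<phi> n\<close>, and the integral matrix
  is absorbed by \<open>v1\<close>. Irreducibility then frees the second argument and after it the
  first.\<close>

lemma form_eq_0:
  assumes "\<And>n z. \<phi> n z = 0"
  shows "\<l> x y z = 0"
proof -
  define P where "P y \<longleftrightarrow> (\<forall>z. \<l> v1 y z = 0)" for y
  have P_k: "P (\<rho>2 k y)" if "P y" and k: "k \<in> GL2_integers av" for k y
    unfolding P_def
  proof
    fix z
    have kG: "k \<in> carrier GL2" using k V1.GL2_integers_subset by blast
    have "\<l> v1 (\<rho>2 k y) z = \<l> (\<rho>1 k v1) (\<rho>2 k y) (\<rho>3 k (\<rho>3 (matrix_inv k) z))"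
      using v1 k kG by (simp add: V3.rep_inverse_cancel fixed_vectors_def)
    also have "\<dots> = 0" using invariant[OF kG] \<open>P y\<close> by (simp add: P_def)
    finally show "\<l> v1 (\<rho>2 k y) z = 0" .
  qed
  have P_diag: "P (\<rho>2 (mat2 a 0 0 d) v2)" if ad: "a \<noteq> 0" "d \<noteq> 0" "av d \<le> av a" for a d
  proof -
    obtain m u where u: "av u = 1" and da: "d / a = \<pi> powi m * u"
      using ad by (metis V1.obtain_valuation divide_eq_0_iff)
    have "m \<ge> 0"
    proof (rule ccontr)
      assume "\<not> m \<ge> 0"
      then have "1 < av \<pi> powi m"
        using one_less_power[of "inverse (av \<pi>)" "nat (- m)"] one_less_inverse[OF V1.av_pi]
        by (simp add: power_int_def)
      moreover have "av (d / a) \<le> 1" using ad V1.av_pos[of a] by (simp add: divide_le_eq_1)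
      ultimately show False using u unfolding da by simp
    qed
    then obtain n where m: "m = int n" using nonneg_int_cases by blast
    have d: "d = a * (\<pi> ^ n * u)" using da ad by (simp add: m field_simps)
    have u0: "u \<noteq> 0" using u by auto
    have "\<rho>2 (mat2 1 0 0 u) v2 = v2" using u by (intro V2.fixed_GL2_integers[OF v2(1)]) auto
    moreover have "\<rho>2 (mat2 (a * \<pi> ^ n) 0 0 (a * \<pi> ^ n))
        (\<rho>2 (mat2 (\<pi> powi (- int n)) 0 0 1) (\<rho>2 (mat2 1 0 0 u) v2)) = \<rho>2 (mat2 a 0 0 d) v2"
      using ad u0 by (simp add: V2.rep_mat2_mult d power_int_minus mult.assoc)
    ultimately show ?thesis
      using ad assms[of n] scalars(2)[of "a * \<pi> ^ n"]
      by (auto simp: P_def \<phi>_def form_linear simp flip: \<open>\<rho>2 _ _ = \<rho>2 (mat2 a 0 0 d) v2\<close>)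
  qed
  \<comment> \<open>Elimination around an entry of largest absolute value involves integral
    unipotent matrices only.\<close>
  have P_max: "P (\<rho>2 (mat2 a b c d) v2)"
    if det: "a * d \<noteq> b * c" and max: "av b \<le> av a" "av c \<le> av a" "av d \<le> av a" for a b c d
  proof -
    have a: "a \<noteq> 0" using det max V1.av_nonneg by (metis V1.av_eq_0_iff mult_zero_left order_antisym mult_zero_right)
    define e where "e = d - b * c / a"
    have "av (b * (c / a)) \<le> av a"
      using max V1.av_pos[OF a] by (intro V1.av_mult_le) (auto simp: divide_le_eq_1)
    then have "av e \<le> av a" unfolding e_def using max by (intro V1.av_diff_le) auto
    moreover have "e \<noteq> 0" using det a by (simp add: e_def field_simps)
    ultimately have "P (\<rho>2 (mat2 a 0 0 e) v2)" using a by (intro P_diag)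
    then have "P (\<rho>2 (mat2 1 0 (c / a) 1) (\<rho>2 (mat2 a 0 0 e) v2))"
      by (rule P_k) (use max V1.av_pos[OF a] in \<open>auto simp: V1.mat2_in_GL2_integers_iff divide_le_eq_1\<close>)
    moreover have "\<rho>2 (mat2 1 (b / a) 0 1) v2 = v2"
      using max V1.av_pos[OF a] by (intro V2.fixed_GL2_integers[OF v2(1)]) (auto simp: divide_le_eq_1)
    then have "\<rho>2 (mat2 1 0 (c / a) 1) (\<rho>2 (mat2 a 0 0 e) v2)
        = \<rho>2 (mat2 1 0 (c / a) 1) (\<rho>2 (mat2 a 0 0 e) (\<rho>2 (mat2 1 (b / a) 0 1) v2))" by simp
    then have "\<rho>2 (mat2 1 0 (c / a) 1) (\<rho>2 (mat2 a 0 0 e) v2) = \<rho>2 (mat2 a b c d) v2"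
      using a \<open>e \<noteq> 0\<close> by (simp add: V2.rep_mat2_mult) (simp add: e_def mult.commute)
    ultimately show ?thesis by simp
  qed
  have J2: "\<rho>2 (mat2 0 1 1 0) v2 = v2" by (rule V2.fixed_GL2_integers[OF v2(1)]) auto
  have J_right: "\<rho>2 (mat2 b a d c) v2 = \<rho>2 (mat2 a b c d) v2" if "a * d \<noteq> b * c" for a b c d
  proof -
    have "\<rho>2 (mat2 b a d c) v2 = \<rho>2 (mat2 a b c d) (\<rho>2 (mat2 0 1 1 0) v2)"
      using that by (simp add: V2.rep_mat2_mult)
    then show ?thesis by (simp add: J2)
  qed
  have J_left: "P (\<rho>2 (mat2 a b c d) v2)"
    if "P (\<rho>2 (mat2 c d a b) v2)" and det: "a * d \<noteq> b * c" for a b c d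
  proof -
    have "P (\<rho>2 (mat2 0 1 1 0) (\<rho>2 (mat2 c d a b) v2))"
      using that(1) by (rule P_k) (simp add: V1.mat2_in_GL2_integers_iff)
    moreover have "c * b \<noteq> d * a" using det by (metis mult.commute)
    ultimately show ?thesis by (simp add: V2.rep_mat2_mult)
  qed
  \<comment> \<open>Row and column swaps, both integral, bring a largest entry to the upper
    left.\<close>
  have P_gen: "P (\<rho>2 g v2)" if g: "g \<in> carrier GL2" for g
  proof -
    obtain a b c d where g: "g = mat2 a b c d" "a * d \<noteq> b * c" using g by (rule GL2_cases)
    then have dets: "b * c \<noteq> a * d" "c * b \<noteq> d * a" "d * a \<noteq> c * b" by (auto simp: mult.commute)
    have top: "P (\<rho>2 (mat2 a b c d) v2)"
      if det: "a * d \<noteq> b * c" and max: "av c \<le> max (av a) (av b)" "av d \<le> max (av a) (av b)" for a b c d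
    proof (cases "av b \<le> av a")
      case True
      then show ?thesis using det max by (intro P_max) auto
    next
      case False
      then have "P (\<rho>2 (mat2 b a d c) v2)" using det max by (intro P_max) auto
      then show ?thesis using J_right[OF det] by simp
    qed
    show ?thesis
    proof (cases "max (av c) (av d) \<le> max (av a) (av b)")
      case True
      then show ?thesis unfolding g(1) using g(2) by (intro top) auto
    next
      case False
      then have "P (\<rho>2 (mat2 c d a b) v2)" using dets by (intro top) auto
      then show ?thesis unfolding g(1) using g(2) by (rule J_left)
    qed
  qed
  have all_y: "P y" for y
    by (rule V2.irreducible_generates[OF irreducible(2), where v = v2])
      (use v2 P_gen in \<open>auto simp: P_def form_linear form_zero\<close>)
  have "\<forall>y z. \<l> x y z = 0"
  proof (rule V1.irreducible_generates[OF irreducible(1), where v = v1 and P = "\<lambda>x. \<forall>y z. \<l> x y z = 0"])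
    fix g :: "'f mat2" assume g: "g \<in> carrier GL2"
    show "\<forall>y z. \<l> (\<rho>1 g v1) y z = 0"
    proof safe
      fix y z
      have "\<l> (\<rho>1 g v1) y z = \<l> (\<rho>1 g v1) (\<rho>2 g (\<rho>2 (matrix_inv g) y)) (\<rho>3 g (\<rho>3 (matrix_inv g) z))"
        using g by (simp add: V2.rep_inverse_cancel V3.rep_inverse_cancel)
      then show "\<l> (\<rho>1 g v1) y z = 0" using g all_y by (simp add: invariant P_def)
    qed
  qed (use v1 in \<open>auto simp: form_linear form_zero\<close>)
  then show ?thesis by blast
qed

end

section \<open>From the \<open>p\<close>-adic hypotheses to the argument on the tree\<close>

lemma (in padic_field) discretely_valued:
  assumes "uniformizer av \<pi>"
  obtains R where "discretely_valued_field av \<pi> R"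
proof -
  obtain R where R: "finite R" "0 \<in> R" "\<And>r. r \<in> R \<Longrightarrow> av r \<le> 1"
    "\<And>x. av x \<le> 1 \<Longrightarrow> \<exists>r\<in>R. av (x - r) < 1"
    "\<And>r s. r \<in> R \<Longrightarrow> s \<in> R \<Longrightarrow> av (r - s) < 1 \<Longrightarrow> r = s"
    by (rule residue_representatives) blast
  \<comment> \<open>The maximal ideal contains the nonzero number \<open>p\<close>.\<close>
  have "\<pi> \<noteq> 0"
  proof
    assume "\<pi> = 0"
    moreover have "of_nat p \<in> (\<lambda>y. \<pi> * y) ` integers av"
      using assms av_prime(1) unfolding uniformizer_def by blast
    ultimately show False using av_prime(2) by auto
  qed
  then have "discretely_valued_field av \<pi> R"
    by unfold_locales (use assms R in auto)
  then show thesis by (rule that)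
qed

theorem theorem5:
  fixes p :: nat and Qp :: "'f::field_char_0 set" and av :: "'f \<Rightarrow> real" and \<pi> :: 'f
    and sc1 :: "complex \<Rightarrow> 'v1::ab_group_add \<Rightarrow> 'v1" and \<rho>1 :: "'f mat2 \<Rightarrow> 'v1 \<Rightarrow> 'v1"
    and sc2 :: "complex \<Rightarrow> 'v2::ab_group_add \<Rightarrow> 'v2" and \<rho>2 :: "'f mat2 \<Rightarrow> 'v2 \<Rightarrow> 'v2"
    and sc3 :: "complex \<Rightarrow> 'v3::ab_group_add \<Rightarrow> 'v3" and \<rho>3 :: "'f mat2 \<Rightarrow> 'v3 \<Rightarrow> 'v3"
    and \<omega>1 \<omega>2 \<omega>3 :: "'f \<Rightarrow> complex" and chi1 chi2 :: "'f mat2 \<Rightarrow> complex"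
    and \<l> :: "'v1 \<Rightarrow> 'v2 \<Rightarrow> 'v3 \<Rightarrow> complex"
    and v1 :: 'v1 and v2 :: 'v2 and v3 :: 'v3
  assumes field: "padic_field p Qp av" "uniformizer av \<pi>"
    and rep1: "GL2_rep sc1 \<rho>1" "irreducible_rep sc1 \<rho>1" "admissible_rep av sc1 \<rho>1"
      "infinite_dimensional sc1"
    and rep2: "GL2_rep sc2 \<rho>2" "irreducible_rep sc2 \<rho>2" "admissible_rep av sc2 \<rho>2"
      "infinite_dimensional sc2"
    and rep3: "GL2_rep sc3 \<rho>3" "irreducible_rep sc3 \<rho>3" "admissible_rep av sc3 \<rho>3"
      "infinite_dimensional sc3"
    and central: "has_central_character sc1 \<rho>1 \<omega>1" "has_central_character sc2 \<rho>2 \<omega>2"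
      "has_central_character sc3 \<rho>3 \<omega>3" "\<And>z. z \<noteq> 0 \<Longrightarrow> \<omega>1 z * \<omega>2 z * \<omega>3 z = 1"
    and unramified: "unramified_character av chi1" "unramified_character av chi2"
    and induced: "isomorphic_to_induced av \<pi> sc1 \<rho>1 chi1" "isomorphic_to_induced av \<pi> sc2 \<rho>2 chi2"
    and conductor: "has_conductor av \<pi> \<rho>3 1"
    and not_minus_one: "chi1 (mat2 \<pi> 0 0 (inverse \<pi>)) \<noteq> -1 \<or> chi2 (mat2 \<pi> 0 0 (inverse \<pi>)) \<noteq> -1"
    and form: "trilinear_form sc1 sc2 sc3 \<l>" "GL2_invariant \<rho>1 \<rho>2 \<rho>3 \<l>" "\<exists>x y z. \<l> x y z \<noteq> 0"
    and vec1: "v1 \<in> fixed_vectors \<rho>1 (GL2_integers av)" "v1 \<noteq> 0"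
    and vec2: "v2 \<in> fixed_vectors \<rho>2 (GL2_integers av)" "v2 \<noteq> 0"
    and vec3: "v3 \<in> fixed_vectors \<rho>3 (Gamma0 av \<pi>)" "v3 \<noteq> 0"
  shows "\<l> v1 (\<rho>2 (matrix_inv (mat2 \<pi> 0 0 1)) v2) v3 \<noteq> 0"
proof
  interpret padic_field p Qp av by (rule field(1))
  obtain R where "discretely_valued_field av \<pi> R" using field(2) by (rule discretely_valued)
  then interpret D: discretely_valued_field av \<pi> R .
  interpret V1: GL2_rep sc1 \<rho>1 by (rule rep1(1))
  interpret V2: GL2_rep sc2 \<rho>2 by (rule rep2(1))
  interpret V3: GL2_rep sc3 \<rho>3 by (rule rep3(1))
  interpret P1: padic_rep av \<pi> R sc1 \<rho>1 ..
  interpret P2: padic_rep av \<pi> R sc2 \<rho>2 ..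
  interpret P3: padic_rep av \<pi> R sc3 \<rho>3 ..
  obtain t1 where t1: "\<rho>1 (mat2 1 0 0 \<pi>) v1 + (\<Sum>u\<in>R. \<rho>1 (mat2 \<pi> u 0 1) v1) = sc1 t1 v1"
    using P1.hecke_eigenvector[OF induced(1) vec1] by blast
  obtain t2 where t2: "\<rho>2 (mat2 \<pi> 0 0 1) v2 + (\<Sum>u\<in>R. \<rho>2 (mat2 1 0 u \<pi>) v2) = sc2 t2 v2"
    using P2.hecke_eigenvector[OF induced(2) vec2] by blast
  \<comment> \<open>\<open>Gamma1 av \<pi> 0\<close> is the full maximal compact subgroup, so the
    minimality in \<open>has_conductor\<close> excludes spherical vectors.\<close>
  have no_spherical: "z = 0" if "z \<in> fixed_vectors \<rho>3 (GL2_integers av)" for z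
    using conductor that D.Gamma1_0 by (simp add: has_conductor_def)
  interpret spherical_pair_form av \<pi> R sc1 \<rho>1 sc2 \<rho>2 sc3 \<rho>3 \<omega>1 \<omega>2 \<omega>3 \<l> v1 v2 t1 t2
    by unfold_locales
      (use rep1(2) rep2(2) rep3(2) central form no_spherical vec1 vec2 t1 t2 in
        \<open>auto simp: GL2_invariant_def\<close>)
  have "matrix_inv (mat2 \<pi> 0 0 1) = mat2 (\<pi> powi (- int 1)) 0 0 1"
    by (rule matrix_inv_eqI) (auto simp: mat2_mult mat_eq_mat2 mat2_in_GL2_iff power_int_minus)
  moreover assume "\<l> v1 (\<rho>2 (matrix_inv (mat2 \<pi> 0 0 1)) v2) v3 = 0"
  ultimately have "\<phi> 1 v3 = 0" by (simp only: \<phi>_def)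
  with vec3 obtain w \<epsilon> where "w \<noteq> 0" "w \<in> fixed_vectors \<rho>3 (Gamma0 av \<pi>)"
    "\<rho>3 (mat2 0 1 \<pi> 0) w = sc3 \<epsilon> w" "\<epsilon> \<noteq> 0" "\<phi> 1 w = 0"
    by (rule obtain_eigenvector)
  then have "\<phi> n z = 0" for n z by (rule \<phi>_eq_0)
  then have "\<l> x y z = 0" for x y z by (rule form_eq_0)
  then show False using form(3) by blast
qed

end
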